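(* Let $n\ge1$ be an integer and $\frac n{n+2}<p<2$. For every $(D,u)\in\Xi_n$ and all tangent vectors $(X,x),(Y,y)\in \mathrm T_n$, the Fisher information of the family $\{f_p(D,u,\cdot):(D,u)\in\Xi_n\}$ is $$g^{(F,p)}_{D,u}((X,x),(Y,y))=\frac1{2(2-p)}\operatorname{Tr}(D^{-1}XD^{-1}Y)+\frac{p-1}{4(2-p)}\operatorname{Tr}(D^{-1}X)\operatorname{Tr}(D^{-1}Y)+\frac{2+n(p-1)}{(2p+n(p-1))(2-p)}\langle x,Dy\rangle.$$
   Context: $\Xi_n=\mathcal M_n\times\mathbb R^n$, where $\mathcal M_n$ is the set of real symmetric strictly positive definite $n\times n$ matrices. Its tangent space at each point is identified with $\mathrm T_n=M_n\times\mathbb R^n$, where $M_n$ is the space of real symmetric $n\times n$ matrices, and for a function $h$ on $\Xi_n$, $\frac{\partial h(D,u)}{\partial(X,x)}=\frac{d}{dt}h(D+tX,u+tx)\big|_{t=0}$. For $p>\frac n{n+2}$, $p\ne1$, the $p$-generalized Gaussian density is $$f_p(D,u,z)=A_{n,p}\sqrt{\det D}\left(1+\tfrac{1-p}{2p-n(1-p)}\langle z-u,D(z-u)\rangle\right)^{\frac1{p-1}}$$ for $z\in\mathrm{Dom}(p,D,u)$ and $0$ otherwise. Here $\mathrm{Dom}(p,D,u)=\mathbb R^n$ if $\frac n{n+2}<p<1$, and $\mathrm{Dom}(p,D,u)=\{z\in\mathbb R^n: 1+\frac{1-p}{2p-n(1-p)}\langle z-u,D(z-u)\rangle\ge0\}$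 if $p>1$. The normalization constant is $A_{n,p}=\left(\frac{1-p}{2p-n(1-p)}\right)^{n/2}\frac{\Gamma(\frac1{1-p})}{\pi^{n/2}\Gamma(\frac1{1-p}-\frac n2)}$ if $\frac n{n+2}<p<1$, and $A_{n,p}=\left(\frac{p-1}{2p-n(1-p)}\right)^{n/2}\frac{\Gamma(\frac p{p-1}+\frac n2)}{\pi^{n/2}\Gamma(\frac p{p-1})}$ if $p>1$. For $p=1$, $f_1(D,u,z)=\frac{\sqrt{\det D}}{(2\pi)^{n/2}}\exp\left(-\frac12\langle z-u,D(z-u)\rangle\right)$. The Fisher information quadratic form is $$g^{(F,p)}_{D,u}((X,x),(Y,y))=\int f_p(D,u,z)\,\frac{\partial\log f_p(D,u,z)}{\partial(X,x)}\,\frac{\partial\log f_p(D,u,z)}{\partial(Y,y)}\,dz,$$ the integral being over $\{z\in\mathbb R^n: f_p(D,u,z)>0\}$ (i.e. over $\mathrm{Dom}(p,D,u)$ up to a null set; this is all of $\mathbb R^n$ when $p\le1$). *)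

theory Defs
  imports "HOL-Analysis.Analysis"
begin

text \<open>
  Throughout, the dimension is \<open>n = CARD('n)\<close>; since types are nonempty, \<open>n \<ge> 1\<close> is automatic.
\<close>

definition sym_matrices :: "(real^'n^'n) set"
  where "sym_matrices = {X. transpose X = X}"

definition pos_def_matrices :: "(real^'n^'n) set"
  where "pos_def_matrices = {D \<in> sym_matrices. \<forall>v. v \<noteq> 0 \<longrightarrow> v \<bullet> (D *v v) > 0}"

definition param_space :: "((real^'n^'n) \<times> (real^'n)) set"
  where "param_space = pos_def_matrices \<times> UNIV"

definition tangent_space :: "((real^'n^'n) \<times> (real^'n)) set"
  where "tangent_space = sym_matrices \<times> UNIV"

text \<open>
  The derivative \<open>\<partial>h(D,u)/\<partial>(X,x)\<close> of a function \<open>h\<close> on the parameter space. For \<open>(D,u)\<close> in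
  the parameter space and tangent \<open>(X,x)\<close>, the curve stays in the parameter space for small
  \<open>t\<close>, so values of \<open>h\<close> outside it are irrelevant.
\<close>

definition tangent_deriv ::
    "((real^'n^'n) \<times> (real^'n) \<Rightarrow> real) \<Rightarrow> (real^'n^'n) \<times> (real^'n) \<Rightarrow> (real^'n^'n) \<times> (real^'n) \<Rightarrow> real"
  where "tangent_deriv h \<theta> V = deriv (\<lambda>t. h (\<theta> + t *\<^sub>R V)) 0"

definition tangent_differentiable ::
    "((real^'n^'n) \<times> (real^'n) \<Rightarrow> real) \<Rightarrow> (real^'n^'n) \<times> (real^'n) \<Rightarrow> (real^'n^'n) \<times> (real^'n) \<Rightarrow> bool"
  where "tangent_differentiable h \<theta> V \<longleftrightarrow> (\<lambda>t::real. h (\<theta> + t *\<^sub>R V)) field_differentiable (at 0)"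

definition gg_base :: "real \<Rightarrow> real^'n^'n \<Rightarrow> real^'n \<Rightarrow> real^'n \<Rightarrow> real"
  where "gg_base p D u z =
    1 + (1 - p) / (2 * p - real CARD('n) * (1 - p)) * ((z - u) \<bullet> (D *v (z - u)))"

definition gg_dom :: "real \<Rightarrow> real^'n^'n \<Rightarrow> real^'n \<Rightarrow> (real^'n) set"
  where "gg_dom p D u = (if p < 1 then UNIV else {z. gg_base p D u z \<ge> 0})"

text \<open>The normalization constant \<open>A\<^bsub>n,p\<^esub>\<close>; only used for \<open>p \<noteq> 1\<close>.\<close>

definition gg_const :: "nat \<Rightarrow> real \<Rightarrow> real"
  where "gg_const n p =
    (if p < 1 then
       ((1 - p) / (2 * p - real n * (1 - p))) powr (real n / 2) *
         (Gamma (1 / (1 - p)) / (pi powr (real n / 2) * Gamma (1 / (1 - p) - real n / 2)))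
     else
       ((p - 1) / (2 * p - real n * (1 - p))) powr (real n / 2) *
         (Gamma (p / (p - 1) + real n / 2) / (pi powr (real n / 2) * Gamma (p / (p - 1)))))"

definition gen_gaussian :: "real \<Rightarrow> (real^'n^'n) \<times> (real^'n) \<Rightarrow> real^'n \<Rightarrow> real"
  where "gen_gaussian p = (\<lambda>(D, u) z.
    if p = 1 then
      sqrt (det D) / (2 * pi) powr (real CARD('n) / 2) * exp (- (1/2) * ((z - u) \<bullet> (D *v (z - u))))
    else if z \<in> gg_dom p D u then
      gg_const CARD('n) p * sqrt (det D) * gg_base p D u z powr (1 / (p - 1))
    else 0)"

definition fisher_integrand ::
    "((real^'n^'n) \<times> (real^'n) \<Rightarrow> real^'n \<Rightarrow> real) \<Rightarrow> (real^'n^'n) \<times> (real^'n) \<Rightarrow>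
      (real^'n^'n) \<times> (real^'n) \<Rightarrow> (real^'n^'n) \<times> (real^'n) \<Rightarrow> real^'n \<Rightarrow> real"
  where "fisher_integrand f \<theta> V W z =
    f \<theta> z * tangent_deriv (\<lambda>\<eta>. ln (f \<eta> z)) \<theta> V * tangent_deriv (\<lambda>\<eta>. ln (f \<eta> z)) \<theta> W"

definition fisher_form ::
    "((real^'n^'n) \<times> (real^'n) \<Rightarrow> real^'n \<Rightarrow> real) \<Rightarrow> (real^'n^'n) \<times> (real^'n) \<Rightarrow>
      (real^'n^'n) \<times> (real^'n) \<Rightarrow> (real^'n^'n) \<times> (real^'n) \<Rightarrow> real"
  where "fisher_form f \<theta> V W = (LINT z:{z. f \<theta> z > 0}|lborel. fisher_integrand f \<theta> V W z)"

end

theory Submission imports Defs begin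

text \<open>
  Put \<open>n = CARD('n)\<close>, \<open>r = 2 * p + n * (p - 1)\<close>, \<open>w = z - u\<close> and \<open>q = w \<bullet> (D *v w)\<close>. The density is \<open>sqrt (det D)\<close> times
  a function of \<open>q\<close> alone, built from the base \<open>1 + (1 - p) / r * q\<close>; let \<open>m(q)\<close> be the reciprocal of this base.
  (For \<open>p = 1\<close> the base is \<open>1\<close>, and the function is the exponential of \<open>- q / 2\<close> up to a constant.) The logarithmic
  derivative of the density in the direction \<open>(X, x)\<close> is

    \<open>trace (matrix_inv D ** X) / 2 - m(q) / r * (w \<bullet> (X *v w) - 2 * (x \<bullet> (D *v w)))\<close>

  (\<open>score_has_derivative\<close>). Choose \<open>B\<close> with \<open>transpose B ** D ** B = mat 1\<close> and substitute \<open>w = B *v v\<close>. Then \<open>q\<close>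
  becomes the squared norm of \<open>v\<close>, the Jacobian cancels \<open>sqrt (det D)\<close>, and \<open>(X, x)\<close> becomes
  \<open>(transpose B ** X ** B, transpose B *v (D *v x))\<close>. Since \<open>B ** transpose B = matrix_inv D\<close>, the traces and the
  inner product in the claim are those of the transformed tangent vectors, and only \<open>D = mat 1\<close> remains
  (\<open>whitened_score_covariance\<close>).

  There the product of two scores is integrated against a radial weight. Terms of odd degree in \<open>v\<close> vanish.
  For the others, the integral of a radial function against a monomial splits into a one-dimensional integral over
  the squared radius and a universal constant, which is found by comparison with the Gaussian weight
  (\<open>nn_integral_homogeneous_radial\<close>, \<open>has_bochner_integral_monomial_radial\<close>). With \<open>E\<close> denoting integration against
  the density, this gives second moments \<open>E (m * v $ i * v $ j) = a * of_bool (i = j)\<close>, the analogous moments of \<open>m^2\<close>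
  with a constant \<open>b\<close>, and fourth moments of \<open>m^2\<close> equal to a constant \<open>d\<close> times the sum over the three pairings of
  the four indices.

  The one-dimensional integrals are Beta and Gamma integrals. The functional equation of the Gamma function, or
  a comparison of powers of \<open>2\<close> when \<open>p = 1\<close>, expresses the three constants through the total mass, which is \<open>1\<close>
  (\<open>profile_moment_normalised\<close>, \<open>profile_moment_step\<close>, \<open>profile_moment_raise_exponent\<close>):

    \<open>a = r / 2\<close>, \<open>b = (2 + n * (p - 1)) * r / (4 * (2 - p))\<close> and \<open>d = r^2 / (4 * (2 - p))\<close>.

  Hence \<open>trace (X ** Y)\<close> gets the coefficient \<open>2 * d / r^2 = 1 / (2 * (2 - p))\<close>, the product of the traces gets
  \<open>1 / 4 - a / r + d / r^2 = (p - 1) / (4 * (2 - p))\<close>, and \<open>x \<bullet> y\<close> gets \<open>4 * b / r^2\<close>. The condition \<open>p < 2\<close> is what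
  makes \<open>m^2\<close> integrable against the density at the edge of the support when \<open>p > 1\<close>.
\<close>

section \<open>Linear changes of variables for Lebesgue measure\<close>

lemma has_bochner_integral_lborel_translate:
  fixes f :: "'a::euclidean_space \<Rightarrow> real"
  assumes "f \<in> borel_measurable borel" "has_bochner_integral lborel (\<lambda>w. f (u + w)) I"
  shows "has_bochner_integral lborel f I"
  using has_bochner_integral_distr[of f borel "(+) u" lborel I] assms by (simp add: lborel_distr_plus)

lemma nn_integral_lborel_split_coordinate:
  fixes b :: "'a::euclidean_space"
  assumes b: "b \<in> Basis" and F [measurable]: "F \<in> borel_measurable (borel :: 'a measure)"
  shows "(\<integral>\<^sup>+v. F v \<partial>lborel) =
    (\<integral>\<^sup>+f. (\<integral>\<^sup>+y. F ((\<Sum>j\<in>Basis - {b}. f j *\<^sub>R j) + y *\<^sub>R b) \<partial>lborel) \<partial>(\<Pi>\<^sub>M j\<in>Basis - {b}. lborel))"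
proof -
  interpret product_sigma_finite "\<lambda>_::'a. lborel :: real measure" ..
  have ins: "Basis = insert b (Basis - {b})" using b by auto
  have "(\<integral>\<^sup>+v. F v \<partial>lborel) =
      (\<integral>\<^sup>+f. F (\<Sum>j\<in>Basis. f j *\<^sub>R j) \<partial>(\<Pi>\<^sub>M j\<in>Basis. lborel))"
    by (subst lborel_eq) (simp add: nn_integral_distr)
  also have "\<dots> = (\<integral>\<^sup>+f. F (\<Sum>j\<in>Basis. f j *\<^sub>R j) \<partial>(\<Pi>\<^sub>M j\<in>insert b (Basis - {b}). lborel))"
    using ins by simp
  also have "\<dots> = (\<integral>\<^sup>+f. (\<integral>\<^sup>+y. F (\<Sum>j\<in>Basis. (f(b := y)) j *\<^sub>R j) \<partial>lborel) \<partial>(\<Pi>\<^sub>M j\<in>Basis - {b}. lborel))"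
    by (rule product_nn_integral_insert) (auto simp: ins[symmetric])
  also have "(\<lambda>f y. \<Sum>j\<in>Basis. (f(b := y)) j *\<^sub>R j) = (\<lambda>f y. (\<Sum>j\<in>Basis - {b}. f j *\<^sub>R j) + y *\<^sub>R b)"
    by (intro ext) (simp add: sum.remove[OF finite_Basis b])
  then have "(\<integral>\<^sup>+f. (\<integral>\<^sup>+y. F (\<Sum>j\<in>Basis. (f(b := y)) j *\<^sub>R j) \<partial>lborel) \<partial>(\<Pi>\<^sub>M j\<in>Basis - {b}. lborel))
     = (\<integral>\<^sup>+f. (\<integral>\<^sup>+y. F ((\<Sum>j\<in>Basis - {b}. f j *\<^sub>R j) + y *\<^sub>R b) \<partial>lborel) \<partial>(\<Pi>\<^sub>M j\<in>Basis - {b}. lborel))"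
    by (simp add: fun_eq_iff)
  finally show ?thesis .
qed

text \<open>On every line parallel to \<open>b\<close> the shear is a translation, because \<open>w\<close> is orthogonal to \<open>b\<close>; Tonelli reduces the claim to translation invariance on the line.\<close>

lemma nn_integral_lborel_shear:
  fixes b w :: "'a::euclidean_space"
  assumes b: "b \<in> Basis" and w: "w \<bullet> b = 0" and F [measurable]: "F \<in> borel_measurable (borel :: 'a measure)"
  shows "(\<integral>\<^sup>+v. F (v + (v \<bullet> w) *\<^sub>R b) \<partial>lborel) = (\<integral>\<^sup>+v. F v \<partial>lborel)"
proof -
  have "(\<integral>\<^sup>+y. F (r + y *\<^sub>R b + ((r + y *\<^sub>R b) \<bullet> w) *\<^sub>R b) \<partial>lborel) = (\<integral>\<^sup>+y. F (r + y *\<^sub>R b) \<partial>lborel)" for r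
  proof -
    have "(\<integral>\<^sup>+y. F (r + y *\<^sub>R b) \<partial>lborel) = (\<integral>\<^sup>+y. F (r + (r \<bullet> w + 1 * y) *\<^sub>R b) \<partial>lborel)"
      using nn_integral_real_affine[of "\<lambda>y. F (r + y *\<^sub>R b)" 1 "r \<bullet> w"] by simp
    also have "\<dots> = (\<integral>\<^sup>+y. F (r + y *\<^sub>R b + ((r + y *\<^sub>R b) \<bullet> w) *\<^sub>R b) \<partial>lborel)"
      using w by (simp add: inner_add_left inner_commute[of b w] scaleR_add_left add_ac)
    finally show ?thesis ..
  qed
  then show ?thesis
    by (simp add: nn_integral_lborel_split_coordinate[OF b])
qed

lemma prod_Basis_vec:
  fixes f :: "real^'n \<Rightarrow> 'b::comm_monoid_mult"
  shows "(\<Prod>b\<in>Basis. f b) = (\<Prod>i\<in>UNIV. f (axis i 1))"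
proof -
  have "Basis = range (\<lambda>i. axis i 1 :: real^'n)" by (auto simp: Basis_vec_def)
  moreover have "inj (\<lambda>i. axis i 1 :: real^'n)" by (auto simp: inj_on_def axis_eq_axis)
  ultimately show ?thesis using prod.reindex[of "\<lambda>i. axis i 1 :: real^'n" UNIV f] by (simp add: o_def)
qed

text \<open>Permuting coordinates maps boxes to boxes with the same side lengths.\<close>

lemma nn_integral_lborel_swap_coordinates:
  fixes F :: "real^'n \<Rightarrow> ennreal"
  assumes F [measurable]: "F \<in> borel_measurable borel" and q: "q permutes UNIV"
  shows "(\<integral>\<^sup>+v. F (\<chi> i. v $ q i) \<partial>lborel) = (\<integral>\<^sup>+v. F v \<partial>lborel)"
proof -
  let ?T = "\<lambda>v::real^'n. \<chi> i. v $ q i"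
  have T [measurable]: "?T \<in> borel_measurable borel"
    by (intro borel_measurable_continuous_onI continuous_intros)
  have "lborel = distr lborel borel ?T"
  proof (rule lborel_eqI)
    fix l u :: "real^'n"
    assume le: "\<And>b. b \<in> Basis \<Longrightarrow> l \<bullet> b \<le> u \<bullet> b"
    then have le': "l $ i \<le> u $ i" for i
      using le[of "axis i 1"] by (simp add: axis_in_Basis_iff inner_axis)
    let ?l = "\<chi> i. l $ inv q i" and ?u = "\<chi> i. u $ inv q i"
    have "?T -` box l u = box ?l ?u"
      using permutes_inverses[OF q] by (auto simp: mem_box_cart) metis+
    then have "emeasure (distr lborel borel ?T) (box l u) = emeasure lborel (box ?l ?u)"
      by (simp add: emeasure_distr)
    also have "\<dots> = ennreal (\<Prod>b\<in>Basis. (?u - ?l) \<bullet> b)"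
      using le' by (subst emeasure_lborel_box) (auto simp: Basis_vec_def inner_axis)
    also have "(\<Prod>b\<in>Basis. (?u - ?l) \<bullet> b) = (\<Prod>i\<in>UNIV. (u - l) $ inv q i)"
      by (simp add: prod_Basis_vec inner_axis)
    also have "\<dots> = (\<Prod>i\<in>UNIV. (u - l) $ i)"
      using permutes_inv[OF q] by (subst prod.permute[of "inv q"]) (auto simp: o_def)
    also have "\<dots> = (\<Prod>b\<in>Basis. (u - l) \<bullet> b)"
      by (simp add: prod_Basis_vec inner_axis)
    finally show "emeasure (distr lborel borel ?T) (box l u) = (\<Prod>b\<in>Basis. (u - l) \<bullet> b)" .
  qed simp
  then have "(\<integral>\<^sup>+v. F v \<partial>lborel) = (\<integral>\<^sup>+v. F v \<partial>distr lborel borel ?T)"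
    by simp
  then show ?thesis by (simp add: nn_integral_distr)
qed

text \<open>Every matrix is a product of matrices with a zero row, diagonal matrices, coordinate swaps and
  shears. The formula is multiplicative in \<open>A\<close>, so it suffices to check these factors; a matrix with a zero
  row is singular and there is nothing to show for it.\<close>

lemma nn_integral_lborel_linear:
  fixes A :: "real^'n^'n"
  assumes F: "F \<in> borel_measurable borel" and det: "det A \<noteq> 0"
  shows "(\<integral>\<^sup>+v. F v \<partial>lborel) = ennreal \<bar>det A\<bar> * (\<integral>\<^sup>+v. F (A *v v) \<partial>lborel)"
proof -
  define P where "P = (\<lambda>A::real^'n^'n. det A \<noteq> 0 \<longrightarrow> (\<forall>F\<in>borel_measurable borel.
    (\<integral>\<^sup>+v. F v \<partial>lborel) = ennreal \<bar>det A\<bar> * (\<integral>\<^sup>+v. F (A *v v) \<partial>lborel)))"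
  have [measurable]: "(*v) A \<in> borel_measurable borel" for A :: "real^'n^'n"
    by (intro borel_measurable_continuous_onI continuous_intros)
  have "P A"
  proof (rule induct_matrix_elementary_alt[of P])
    fix A B assume A: "P A" and B: "P B"
    show "P (A ** B)" unfolding P_def
    proof (intro impI ballI)
      fix F :: "real^'n \<Rightarrow> ennreal" assume F [measurable]: "F \<in> borel_measurable borel"
      assume "det (A ** B) \<noteq> 0"
      then have nz: "det A \<noteq> 0" "det B \<noteq> 0" by (auto simp: det_mul)
      have "(\<integral>\<^sup>+v. F v \<partial>lborel) = ennreal \<bar>det A\<bar> * (\<integral>\<^sup>+v. F (A *v v) \<partial>lborel)"
        using A nz F unfolding P_def by blast
      also have "(\<integral>\<^sup>+v. F (A *v v) \<partial>lborel) = ennreal \<bar>det B\<bar> * (\<integral>\<^sup>+v. F (A *v (B *v v)) \<partial>lborel)"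
        using B[unfolded P_def, rule_format, of "\<lambda>v. F (A *v v)"] nz by simp
      finally show "(\<integral>\<^sup>+v. F v \<partial>lborel) = ennreal \<bar>det (A ** B)\<bar> * (\<integral>\<^sup>+v. F ((A ** B) *v v) \<partial>lborel)"
        by (simp add: det_mul abs_mult ennreal_mult mult.assoc matrix_vector_mul_assoc)
    qed
  next
    fix A :: "real^'n^'n" and i assume "row i A = 0"
    then show "P A" by (simp add: P_def det_zero_row)
  next
    fix A :: "real^'n^'n" assume diag: "\<And>i j. i \<noteq> j \<Longrightarrow> A $ i $ j = 0"
    show "P A" unfolding P_def
    proof (intro impI ballI)
      fix F :: "real^'n \<Rightarrow> ennreal" assume F [measurable]: "F \<in> borel_measurable borel"
      assume nz: "det A \<noteq> 0"
      have det: "det A = (\<Prod>i\<in>UNIV. A $ i $ i)" using diag by (rule det_diagonal)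
      let ?c = "\<lambda>b. (A *v b) \<bullet> b"
      have c: "?c (axis i 1) = A $ i $ i" for i
        by (simp add: matrix_vector_mult_basis inner_axis column_def)
      have nzc: "b \<in> Basis \<Longrightarrow> ?c b \<noteq> 0" for b
        using nz c by (auto simp: Basis_vec_def det)
      have T: "(\<Sum>j\<in>Basis. (?c j * (x \<bullet> j)) *\<^sub>R j) = A *v x" for x
      proof -
        have "(\<Sum>j\<in>Basis. (?c j * (x \<bullet> j)) *\<^sub>R j) \<bullet> axis i 1 = (A *v x) \<bullet> axis i 1" for i
        proof -
          have "(A *v x) $ i = (\<Sum>j\<in>UNIV. if j = i then A $ i $ i * x $ i else 0)"
            unfolding matrix_vector_mult_def by (simp only: vec_lambda_beta, intro sum.cong) (auto simp: diag)
          then show ?thesis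
            by (subst inner_sum_left_Basis) (simp_all add: c[unfolded inner_axis, simplified] inner_axis cart_eq_inner_axis[symmetric])
        qed
        then show ?thesis by (simp add: vec_eq_iff inner_axis)
      qed
      have "lborel = density (distr lborel borel ((*v) A)) (\<lambda>_. \<Prod>j\<in>Basis. \<bar>?c j\<bar>)"
        using lborel_affine_euclidean[of ?c 0, OF nzc] by (simp add: T)
      moreover have "(\<Prod>j\<in>Basis. \<bar>?c j\<bar>) = \<bar>det A\<bar>"
        by (simp add: prod_Basis_vec c det abs_prod)
      ultimately have "lborel = density (distr lborel borel ((*v) A)) (\<lambda>_. \<bar>det A\<bar>)" by simp
      then have "(\<integral>\<^sup>+v. F v \<partial>lborel) = (\<integral>\<^sup>+v. F v \<partial>density (distr lborel borel ((*v) A)) (\<lambda>_. \<bar>det A\<bar>))"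
        by simp
      then show "(\<integral>\<^sup>+v. F v \<partial>lborel) = ennreal \<bar>det A\<bar> * (\<integral>\<^sup>+v. F (A *v v) \<partial>lborel)"
        by (simp add: nn_integral_density nn_integral_distr nn_integral_cmult)
    qed
  next
    fix m n :: 'n assume "m \<noteq> n"
    \<comment> \<open>A transposition of two coordinates is an involution, so its determinant is a sign.\<close>
    let ?A = "\<chi> i j. mat 1 $ i $ Transposition.transpose m n j :: real^'n^'n"
    have mv: "?A *v v = (\<chi> i. v $ Transposition.transpose m n i)" for v
    proof -
      have "(\<Sum>j\<in>UNIV. mat 1 $ i $ Transposition.transpose m n j * v $ j) = v $ Transposition.transpose m n i" for i
      proof -
        have "(\<Sum>j\<in>UNIV. mat 1 $ i $ Transposition.transpose m n j * v $ j) =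
            (\<Sum>j\<in>UNIV. if j = Transposition.transpose m n i then v $ j else 0)"
          by (intro sum.cong) (auto simp: mat_def)
        then show ?thesis by simp
      qed
      then show ?thesis by (simp add: matrix_vector_mult_def vec_eq_iff)
    qed
    have "?A ** ?A = mat 1"
      by (simp only: matrix_eq matrix_vector_mul_assoc[symmetric] mv) (simp add: vec_eq_iff)
    then have "det ?A * det ?A = 1"
      by (metis det_mul det_I)
    then have "\<bar>det ?A\<bar> = 1"
      by (auto simp: square_eq_1_iff)
    then show "P ?A"
      unfolding P_def mv using nn_integral_lborel_swap_coordinates[OF _ permutes_swap_id[of m UNIV n]] by simp
  next
    fix m n :: 'n assume mn: "m \<noteq> n"
    let ?A = "\<chi> i j. of_bool (i = m \<and> j = n \<or> i = j) :: real^'n^'n"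
    have mv: "?A *v v = v + (v \<bullet> axis n 1) *\<^sub>R axis m 1" for v
    proof -
      have "(\<Sum>j\<in>UNIV. of_bool (i = m \<and> j = n \<or> i = j) * v $ j) = v $ i + (if i = m then v $ n else 0)" for i
      proof -
        have "(\<Sum>j\<in>UNIV. of_bool (i = m \<and> j = n \<or> i = j) * v $ j) =
            (\<Sum>j\<in>UNIV. (if j = i then v $ i else 0) + (if j = n then if i = m then v $ n else 0 else 0))"
          using mn by (intro sum.cong) auto
        then show ?thesis by (simp add: sum.distrib)
      qed
      then show ?thesis by (simp add: matrix_vector_mult_def vec_eq_iff inner_axis) (simp add: axis_def)
    qed
    have "?A = (\<chi> k. if k = m then row m (mat 1) + 1 *s row n (mat 1) else row k (mat 1))"
      using mn by (auto simp: vec_eq_iff row_def mat_def)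
    then have "det ?A = 1"
      using det_row_operation[OF mn, of "mat 1 :: real^'n^'n" 1] by simp
    moreover have "axis n 1 \<bullet> (axis m 1 :: real^'n) = 0"
      using mn by (simp add: inner_axis_axis)
    ultimately show "P ?A"
      unfolding P_def mv using nn_integral_lborel_shear[of "axis m 1 :: real^'n" "axis n 1"] by simp
  qed
  then show ?thesis using assms unfolding P_def by blast
qed

lemma has_bochner_integral_lborel_linear:
  fixes A :: "real^'n^'n" and f :: "real^'n \<Rightarrow> real"
  assumes f [measurable]: "f \<in> borel_measurable borel" and det: "det A \<noteq> 0"
    and I: "has_bochner_integral lborel (\<lambda>v. \<bar>det A\<bar> * f (A *v v)) I"
  shows "has_bochner_integral lborel f I"
proof -
  have A [measurable]: "(*v) A \<in> borel_measurable borel"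
    by (intro borel_measurable_continuous_onI continuous_intros)
  have "lborel = density (distr lborel borel ((*v) A)) (\<lambda>_. ennreal \<bar>det A\<bar>)" (is "_ = ?N")
  proof (rule measure_eqI)
    fix S :: "(real^'n) set" assume "S \<in> sets lborel"
    then have [measurable]: "S \<in> sets borel" by simp
    have "emeasure lborel S = (\<integral>\<^sup>+v. indicator S v \<partial>lborel)" by simp
    also have "\<dots> = ennreal \<bar>det A\<bar> * (\<integral>\<^sup>+v. indicator S (A *v v) \<partial>lborel)"
      using det by (intro nn_integral_lborel_linear) auto
    also have "\<dots> = (\<integral>\<^sup>+v. ennreal \<bar>det A\<bar> * indicator S (A *v v) \<partial>lborel)"
      by (subst nn_integral_cmult) auto
    also have "\<dots> = (\<integral>\<^sup>+v. ennreal \<bar>det A\<bar> * indicator S v \<partial>distr lborel borel ((*v) A))"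
      by (subst nn_integral_distr) auto
    also have "\<dots> = emeasure ?N S"
      by (subst emeasure_density) auto
    finally show "emeasure lborel S = emeasure ?N S" .
  qed simp
  moreover have "has_bochner_integral ?N f I"
    using I by (intro has_bochner_integral_density) (auto intro!: has_bochner_integral_distr)
  ultimately show ?thesis by simp
qed

section \<open>Whitening matrices and the derivative of the determinant\<close>

text \<open>Gram-Schmidt orthogonalisation for the inner product defined by \<open>D\<close>, one index at a time.\<close>

lemma pos_def_orthonormal_family:
  fixes D :: "real^'n^'n" and I :: "'n set"
  assumes D: "D \<in> pos_def_matrices"
  shows "\<exists>f. \<forall>i\<in>I. \<forall>j\<in>I. f i \<bullet> (D *v f j) = (if i = j then 1 else 0)"
proof -
  have sym: "v \<bullet> (D *v w) = w \<bullet> (D *v v)" for v w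
    using D by (metis (mono_tags, lifting) dot_lmul_matrix inner_commute mem_Collect_eq pos_def_matrices_def sym_matrices_def transpose_matrix_vector)
  have pos: "v \<noteq> 0 \<Longrightarrow> v \<bullet> (D *v v) > 0" for v
    using D by (simp add: pos_def_matrices_def)
  have "finite I" by simp
  then show ?thesis
  proof (induction I)
    case empty
    then show ?case by simp
  next
    case (insert k I)
    then obtain f :: "'n \<Rightarrow> real^'n" where f: "\<forall>i\<in>I. \<forall>j\<in>I. f i \<bullet> (D *v f j) = (if i = j then 1 else 0)"
      by blast
    \<comment> \<open>Fewer than \<open>CARD('n)\<close> vectors cannot span, so there is a new direction to orthogonalise.\<close>
    have "dim (span (f ` I)) \<le> card I"
      by (metis card_image_le dim_le_card' dim_span finite insert.hyps(1) finite_imageI le_trans)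
    also have "\<dots> < CARD('n)"
      using insert.hyps by (metis UNIV_I finite psubset_card_mono psubset_eq subset_UNIV)
    finally have "span (f ` I) \<noteq> UNIV" by (auto simp del: dim_span)
    then obtain a where a: "a \<notin> span (f ` I)" by auto
    define w where "w = a - (\<Sum>i\<in>I. (f i \<bullet> (D *v a)) *\<^sub>R f i)"
    have "(\<Sum>i\<in>I. (f i \<bullet> (D *v a)) *\<^sub>R f i) \<in> span (f ` I)"
      by (intro span_sum span_scale span_base) auto
    with a have "w \<noteq> 0" by (auto simp: w_def)
    then have q: "w \<bullet> (D *v w) > 0" by (rule pos)
    have orth: "f j \<bullet> (D *v w) = 0" if "j \<in> I" for j
    proof -
      have "f j \<bullet> (D *v w) = f j \<bullet> (D *v a) - (\<Sum>i\<in>I. (f i \<bullet> (D *v a)) * (f j \<bullet> (D *v f i)))"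
        by (simp add: w_def matrix_vector_mult_diff_distrib inner_diff_right inner_sum_right
            vec.linear_sum[OF matrix_vector_mul_linear_gen] matrix_vector_mult_scaleR linear_sum[OF matrix_vector_mul_linear])
      also have "(\<Sum>i\<in>I. (f i \<bullet> (D *v a)) * (f j \<bullet> (D *v f i))) = (\<Sum>i\<in>I. if i = j then f i \<bullet> (D *v a) else 0)"
        using f that by (intro sum.cong) auto
      also have "f j \<bullet> (D *v a) - \<dots> = 0"
        using that insert.hyps by simp
      finally show ?thesis .
    qed
    define g where "g = f(k := (1 / sqrt (w \<bullet> (D *v w))) *\<^sub>R w)"
    have orth': "w \<bullet> (D *v f j) = 0" if "j \<in> I" for j
      using orth[OF that] sym[of w "f j"] by simp
    have unit: "(1 / sqrt (w \<bullet> (D *v w))) * (1 / sqrt (w \<bullet> (D *v w))) * (w \<bullet> (D *v w)) = 1"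
      using q by (simp add: divide_simps)
    have "g i \<bullet> (D *v g j) = (if i = j then 1 else 0)" if "i \<in> insert k I" "j \<in> insert k I" for i j
      using that f insert.hyps unit
      by (auto simp: g_def matrix_vector_mult_scaleR orth orth' mult.assoc)
    then show ?case by blast
  qed
qed

text \<open>The columns of \<open>B\<close> are the orthonormal family. The substitution \<open>w = B *v v\<close> then turns the
  quadratic form of \<open>D\<close> into the squared norm of \<open>v\<close>.\<close>

lemma pos_def_whitening_matrix:
  fixes D :: "real^'n^'n"
  assumes D: "D \<in> pos_def_matrices"
  obtains B :: "real^'n^'n" where "transpose B ** D ** B = mat 1"
proof -
  obtain f :: "'n \<Rightarrow> real^'n" where f: "\<forall>i j. f i \<bullet> (D *v f j) = (if i = j then 1 else 0)"
    using pos_def_orthonormal_family[OF D, of UNIV] by auto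
  define B where "B = transpose (\<chi> i. f i)"
  have "(transpose B ** (D ** B)) $ i $ j = mat 1 $ i $ j" for i j
  proof -
    have "(transpose B ** (D ** B)) $ i $ j = f i \<bullet> column j (D ** B)"
      by (simp add: matrix_matrix_mult_def B_def transpose_transpose column_def inner_vec_def)
    also have "column j (D ** B) = D *v f j"
      by (simp add: B_def column_def matrix_matrix_mult_def matrix_vector_mult_def transpose_def vec_eq_iff)
    finally show ?thesis using f by (simp add: mat_def)
  qed
  then have "transpose B ** D ** B = mat 1" by (simp add: vec_eq_iff matrix_mul_assoc)
  then show ?thesis by (rule that)
qed

lemma whitening_matrix_properties:
  fixes B D :: "real^'n^'n"
  assumes "transpose B ** D ** B = mat 1"
  shows "B ** transpose B ** D = mat 1" "D ** (B ** transpose B) = mat 1"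
    and "matrix_inv D = B ** transpose B" and "det B * det B * det D = 1"
proof -
  have "B ** (transpose B ** D) = mat 1"
    using assms matrix_left_right_inverse by blast
  then show 1: "B ** transpose B ** D = mat 1" by (simp add: matrix_mul_assoc)
  then show 2: "D ** (B ** transpose B) = mat 1"
    using matrix_left_right_inverse by blast
  have "D ** matrix_inv D = mat 1"
    unfolding matrix_inv_def using 1 2 by (rule_tac someI2[of _ "B ** transpose B"]) auto
  then have "(B ** transpose B ** D) ** matrix_inv D = B ** transpose B"
    by (metis matrix_mul_assoc matrix_mul_rid)
  then show "matrix_inv D = B ** transpose B" by (simp add: 1)
  have "det (transpose B ** D ** B) = 1" using assms by simp
  then show "det B * det B * det D = 1" by (simp add: det_mul algebra_simps)
qed

lemma pos_def_det_pos:
  fixes D :: "real^'n^'n"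
  assumes "D \<in> pos_def_matrices"
  shows "det D > 0"
proof -
  obtain B :: "real^'n^'n" where "transpose B ** D ** B = mat 1" using pos_def_whitening_matrix[OF assms] .
  then have *: "det B * det B * det D = 1" by (rule whitening_matrix_properties)
  then have "det B \<noteq> 0" by auto
  then have "det B * det B > 0" using zero_less_mult_iff[of "det B" "det B"] by linarith
  then show ?thesis using * by (metis zero_less_mult_pos zero_less_one)
qed

text \<open>In the Leibniz expansion only the identity permutation contributes to first order: its term is the
  product of the diagonal entries \<open>1 + t * X $ i $ i\<close>.\<close>

lemma det_one_plus_has_derivative_trace:
  fixes X :: "real^'n^'n"
  shows "((\<lambda>t. det (mat 1 + t *\<^sub>R X)) has_real_derivative trace X) (at 0)"
proof -
  let ?I = "mat 1 :: real^'n^'n"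
  let ?d = "\<lambda>\<sigma>. of_int (sign \<sigma>) * (\<Sum>i\<in>UNIV. X $ i $ \<sigma> i * (\<Prod>j\<in>UNIV - {i}. ?I $ j $ \<sigma> j))"
  have "((\<lambda>t. of_int (sign \<sigma>) * (\<Prod>i\<in>UNIV. (?I + t *\<^sub>R X) $ i $ \<sigma> i)) has_real_derivative ?d \<sigma>) (at 0)" for \<sigma>
  proof -
    have "((\<lambda>t. \<Prod>i\<in>UNIV. ?I $ i $ \<sigma> i + t * X $ i $ \<sigma> i) has_real_derivative
        (\<Sum>i\<in>UNIV. X $ i $ \<sigma> i * (\<Prod>j\<in>UNIV - {i}. ?I $ j $ \<sigma> j + 0 * X $ j $ \<sigma> j))) (at 0)"
      by (rule has_field_derivative_prod) (auto intro!: derivative_eq_intros)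
    then show ?thesis by (intro DERIV_cmult) simp
  qed
  then have "((\<lambda>t. det (?I + t *\<^sub>R X)) has_real_derivative (\<Sum>\<sigma> | \<sigma> permutes UNIV. ?d \<sigma>)) (at 0)"
    unfolding det_def by (rule DERIV_sum)
  moreover have "(\<Sum>\<sigma> | \<sigma> permutes UNIV. ?d \<sigma>) = (\<Sum>\<sigma> | \<sigma> permutes (UNIV::'n set). if \<sigma> = id then trace X else 0)"
  proof (intro sum.cong refl)
    fix \<sigma> :: "'n \<Rightarrow> 'n" assume "\<sigma> \<in> {\<sigma>. \<sigma> permutes UNIV}"
    then have \<sigma>: "inj \<sigma>" by (simp add: permutes_inj)
    show "?d \<sigma> = (if \<sigma> = id then trace X else 0)"
    proof (cases "\<sigma> = id")
      case True
      then show ?thesis by (simp add: trace_def mat_def sign_id)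
    next
      case False
      \<comment> \<open>A permutation other than the identity moves at least two points, so an off-diagonal
        entry of the identity survives the deletion of any one factor.\<close>
      have "(\<Prod>j\<in>UNIV - {i}. ?I $ j $ \<sigma> j) = 0" for i
      proof -
        obtain k where k: "\<sigma> k \<noteq> k" using False by (auto simp: fun_eq_iff)
        then have "\<sigma> (\<sigma> k) \<noteq> \<sigma> k" using \<sigma> by (auto dest: injD)
        with k obtain j where "j \<in> UNIV - {i}" "\<sigma> j \<noteq> j" by (metis DiffI UNIV_I singletonD)
        then show ?thesis by (intro prod_zero) (auto simp: mat_def intro!: bexI[of _ j])
      qed
      then have "?d \<sigma> = 0" by (simp only: mult_zero_right sum.neutral_const)
      with False show ?thesis by simp
    qed
  qed
  ultimately show ?thesis by (simp add: permutes_id)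
qed

section \<open>Integrals of monomials against radial functions\<close>

text \<open>Polar coordinates without a surface measure. By scaling, the measure with density \<open>P\<close> gives the
  ball of squared radius \<open>r\<close> the mass \<open>M * r powr k\<close>. Hence its image under the squared norm has the density
  \<open>k * M * s powr (k - 1)\<close>, whatever the shape of \<open>P\<close>.\<close>

lemma nn_integral_homogeneous_radial:
  fixes P :: "'a::euclidean_space \<Rightarrow> real" and g :: "real \<Rightarrow> ennreal"
  assumes P [measurable]: "P \<in> borel_measurable borel" and P_nonneg: "\<And>v. P v \<ge> 0"
    and hom: "\<And>c v. c > 0 \<Longrightarrow> P (c *\<^sub>R v) = c ^ d * P v"
    and k: "k = (DIM('a) + real d) / 2"
    and M: "(\<integral>\<^sup>+v\<in>cball 0 1. ennreal (P v) \<partial>lborel) = ennreal M" "M \<ge> 0"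
    and g [measurable]: "g \<in> borel_measurable borel"
  shows "(\<integral>\<^sup>+v. g ((norm v)\<^sup>2) * ennreal (P v) \<partial>lborel) =
    ennreal (k * M) * (\<integral>\<^sup>+s\<in>{0<..}. g s * ennreal (s powr (k - 1)) \<partial>lborel)"
proof -
  have [measurable]: "cball (0::'a) 1 \<in> sets borel" by (intro borel_closed closed_cball)
  have k_pos: "k > 0" by (simp add: k add_pos_nonneg)
  define \<mu> where "\<mu> = distr (density lborel P) borel (\<lambda>v. (norm v)\<^sup>2)"
  define \<nu> where "\<nu> = density lborel (\<lambda>s::real. ennreal (k * M) * ennreal (s powr (k - 1)) * indicator {0<..} s)"
  have \<mu>: "emeasure \<mu> {..r} = ennreal (r powr k * M * of_bool (r > 0))" for r
  proof -
    have "emeasure \<mu> {..r} = (\<integral>\<^sup>+v. ennreal (P v) * indicator {v. (norm v)\<^sup>2 \<le> r} v \<partial>lborel)" (is "_ = ?I")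
      unfolding \<mu>_def by (subst emeasure_distr) (auto simp: emeasure_density vimage_def intro!: nn_integral_cong split: split_indicator)
    also have "?I = ennreal (r powr k * M * of_bool (r > 0))"
    proof (cases "r > 0")
      case False
      have "?I = (\<integral>\<^sup>+v. 0 \<partial>(lborel::'a measure))"
      proof (rule nn_integral_cong_AE)
        show "AE v in lborel. ennreal (P v) * indicator {v. (norm v)\<^sup>2 \<le> r} v = 0"
          using AE_lborel_singleton[of "0::'a"]
        proof eventually_elim
          case (elim v)
          then have "(norm v)\<^sup>2 > 0" by simp
          with False have "\<not> (norm v)\<^sup>2 \<le> r" by linarith
          then show ?case by simp
        qed
      qed
      with False show ?thesis by simp
    next
      case True
      have "?I = (\<integral>\<^sup>+v. ennreal (P v) * indicator {v. (norm v)\<^sup>2 \<le> r} v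
          \<partial>density (distr lborel borel (\<lambda>x. 0 + sqrt r *\<^sub>R x)) (\<lambda>_. \<bar>sqrt r\<bar> ^ DIM('a)))"
        using True by (subst lborel_affine[where c = "sqrt r" and t = 0]) simp_all
      also have "\<dots> = ennreal (sqrt r ^ DIM('a)) * (\<integral>\<^sup>+v. ennreal (P (sqrt r *\<^sub>R v)) * indicator {v. (norm v)\<^sup>2 \<le> r} (sqrt r *\<^sub>R v) \<partial>lborel)"
        using True by (simp add: nn_integral_density nn_integral_distr nn_integral_cmult)
      also have "(\<integral>\<^sup>+v. ennreal (P (sqrt r *\<^sub>R v)) * indicator {v. (norm v)\<^sup>2 \<le> r} (sqrt r *\<^sub>R v) \<partial>lborel)
          = (\<integral>\<^sup>+v. ennreal (sqrt r ^ d) * (ennreal (P v) * indicator (cball 0 1) v) \<partial>lborel)"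
        using True by (intro nn_integral_cong)
          (auto simp: hom ennreal_mult P_nonneg power_mult_distrib abs_square_le_1 split: split_indicator)
      also have "\<dots> = ennreal (sqrt r ^ d) * ennreal M"
        using M by (subst nn_integral_cmult) auto
      also have "ennreal (sqrt r ^ DIM('a)) * (ennreal (sqrt r ^ d) * ennreal M) = ennreal (sqrt r ^ (DIM('a) + d) * M)"
        using True M by (simp add: ennreal_mult[symmetric] power_add mult.assoc)
      also have "sqrt r ^ (DIM('a) + d) = r powr k"
        using True by (simp add: k powr_half_sqrt[symmetric] powr_realpow[symmetric] powr_powr)
      finally show ?thesis using True by simp
    qed
    finally show ?thesis .
  qed
  have \<nu>: "emeasure \<nu> {..r} = ennreal (r powr k * M * of_bool (r > 0))" for r
  proof -
    have "emeasure \<nu> {..r} = (\<integral>\<^sup>+s. ennreal (k * M) * (ennreal (s powr (k - 1)) * indicator {0<..} s * indicator {..r} s) \<partial>lborel)"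
      unfolding \<nu>_def by (subst emeasure_density) (auto simp: mult.assoc)
    also have "\<dots> = ennreal (k * M) * (\<integral>\<^sup>+s. ennreal (s powr (k - 1)) * indicator {0<..} s * indicator {..r} s \<partial>lborel)"
      by (rule nn_integral_cmult) auto
    also have "(\<integral>\<^sup>+s. ennreal (s powr (k - 1)) * indicator {0<..} s * indicator {..r} s \<partial>lborel) = ennreal (r powr k / k * of_bool (r > 0))"
    proof (cases "r > 0")
      case True
      have "(\<integral>\<^sup>+s. ennreal (s powr (k - 1)) * indicator {0<..} s * indicator {..r} s \<partial>lborel) =
          (\<integral>\<^sup>+s. ennreal (indicator {0..r} s * s powr (k - 1)) \<partial>lborel)"
        by (intro nn_integral_cong) (auto split: split_indicator)
      also have "\<dots> = ennreal (r powr k / k)"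
        using nn_integral_has_integral_lebesgue[OF _ has_integral_powr_from_0[of "k - 1" r]] k_pos True by simp
      finally show ?thesis using True by simp
    next
      case False
      then have "(\<integral>\<^sup>+s. ennreal (s powr (k - 1)) * indicator {0<..} s * indicator {..r} s \<partial>lborel) = (\<integral>\<^sup>+s. 0 \<partial>(lborel::real measure))"
        by (intro nn_integral_cong) (auto split: split_indicator)
      with False show ?thesis by simp
    qed
    finally show ?thesis using k_pos M by (simp add: ennreal_mult'[symmetric] mult.commute)
  qed
  \<comment> \<open>The half-lines \<open>{..r}\<close> generate the Borel sets and exhaust the line with finite measure.\<close>
  have "\<mu> = \<nu>"
  proof (rule measure_eqI_generator_eq)
    show "Int_stable (range (atMost :: real \<Rightarrow> _))"
      by (auto simp: Int_stable_def intro!: exI[of _ "min _ _"])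
    show "sets \<mu> = sigma_sets UNIV (range atMost)" "sets \<nu> = sigma_sets UNIV (range atMost)"
      by (simp_all add: \<mu>_def \<nu>_def borel_eq_atMost)
    show "emeasure \<mu> X = emeasure \<nu> X" if "X \<in> range atMost" for X
      using that \<mu> \<nu> by auto
    show "range (\<lambda>i::nat. {..real i}) \<subseteq> range atMost" by auto
    show "(\<Union>i::nat. {..real i}) = UNIV" using real_arch_simple by auto
    show "emeasure \<mu> {..real i} \<noteq> \<infinity>" for i by (simp add: \<mu>)
  qed auto
  have "(\<integral>\<^sup>+v. g ((norm v)\<^sup>2) * ennreal (P v) \<partial>lborel) = (\<integral>\<^sup>+s. g s \<partial>\<mu>)"
    unfolding \<mu>_def by (simp add: nn_integral_distr nn_integral_density mult.commute)
  also have "\<dots> = (\<integral>\<^sup>+s. ennreal (k * M) * (g s * ennreal (s powr (k - 1)) * indicator {0<..} s) \<partial>lborel)"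
    unfolding \<open>\<mu> = \<nu>\<close> \<nu>_def by (subst nn_integral_density) (auto simp: mult_ac)
  also have "\<dots> = ennreal (k * M) * (\<integral>\<^sup>+s\<in>{0<..}. g s * ennreal (s powr (k - 1)) \<partial>lborel)"
    by (rule nn_integral_cmult) auto
  finally show ?thesis .
qed

lemma nn_integral_Gamma_scaled:
  fixes a l :: real
  assumes a: "a > 0" and l: "l > 0"
  shows "(\<integral>\<^sup>+s\<in>{0<..}. ennreal (exp (- (l * s)) * s powr (a - 1)) \<partial>lborel) = ennreal (Gamma a / l powr a)"
proof -
  have "ennreal (Gamma a) = (\<integral>\<^sup>+t. ennreal (indicator {0..} t * t powr (a - 1) / exp t) \<partial>lborel)"
    using a by (rule Gamma_conv_nn_integral_real)
  also have "\<dots> = ennreal l * (\<integral>\<^sup>+t. ennreal (indicator {0..} (l * t) * (l * t) powr (a - 1) / exp (l * t)) \<partial>lborel)"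
    using l by (subst nn_integral_real_affine[where c = l and t = 0]) auto
  also have "\<dots> = (\<integral>\<^sup>+t. ennreal l * ennreal (indicator {0..} (l * t) * (l * t) powr (a - 1) / exp (l * t)) \<partial>lborel)"
    by (subst nn_integral_cmult) auto
  also have "\<dots> = (\<integral>\<^sup>+s. ennreal (l powr a) * (ennreal (exp (- (l * s)) * s powr (a - 1)) * indicator {0<..} s) \<partial>lborel)"
    using l by (intro nn_integral_cong)
      (auto simp: ennreal_mult'[symmetric] powr_mult powr_diff exp_minus zero_le_mult_iff field_simps split: split_indicator)
  also have "\<dots> = ennreal (l powr a) * (\<integral>\<^sup>+s\<in>{0<..}. ennreal (exp (- (l * s)) * s powr (a - 1)) \<partial>lborel)"
    by (subst nn_integral_cmult) auto
  finally have "ennreal (Gamma a) = ennreal (l powr a) * (\<integral>\<^sup>+s\<in>{0<..}. ennreal (exp (- (l * s)) * s powr (a - 1)) \<partial>lborel)" .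
  moreover have "ennreal (Gamma a / l powr a) = ennreal (1 / l powr a) * ennreal (Gamma a)"
    by (simp add: ennreal_mult'[symmetric] del: divide_ennreal)
  ultimately have "ennreal (Gamma a / l powr a) = (ennreal (1 / l powr a) * ennreal (l powr a)) * (\<integral>\<^sup>+s\<in>{0<..}. ennreal (exp (- (l * s)) * s powr (a - 1)) \<partial>lborel)"
    by (simp only: mult.assoc)
  also have "ennreal (1 / l powr a) * ennreal (l powr a) = 1"
    using l by (subst ennreal_mult'[symmetric]) auto
  finally show ?thesis by simp
qed

text \<open>The one-dimensional case of the radial formula, where the constant \<open>M = 1 / k\<close> is an elementary integral.\<close>

lemma nn_integral_gaussian_moment:
  "(\<integral>\<^sup>+x. ennreal (exp (- x\<^sup>2) * \<bar>x\<bar> ^ d) \<partial>lborel) = ennreal (Gamma ((real d + 1) / 2))"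
proof -
  define k where "k = (1 + real d) / 2"
  have k: "k > 0" by (simp add: k_def add_pos_nonneg)
  have M: "(\<integral>\<^sup>+v\<in>cball 0 1. ennreal (\<bar>v\<bar> ^ d) \<partial>(lborel :: real measure)) = ennreal (1 / k)"
  proof -
    have "((\<lambda>x. x ^ Suc d / real (Suc d)) has_vector_derivative x ^ d) (at x within S)" for x :: real and S
      using DERIV_cdivide[OF DERIV_pow[of "Suc d" x S], of "real (Suc d)"]
      by (simp add: has_real_derivative_iff_has_vector_derivative)
    then have "((\<lambda>x::real. x ^ d) has_integral 1 ^ Suc d / real (Suc d) - 0 ^ Suc d / real (Suc d)) {0..1}"
      by (intro fundamental_theorem_of_calculus) auto
    then have "((\<lambda>x::real. x ^ d) has_integral 1 / real (Suc d)) {0..1}"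
      by simp
    then have 1: "((\<lambda>x::real. \<bar>x\<bar> ^ d) has_integral 1 / real (Suc d)) {0..1}"
      by (rule has_integral_eq[rotated]) auto
    then have "((\<lambda>x::real. \<bar>x\<bar> ^ d) has_integral 1 / real (Suc d)) {-1..0}"
      using has_integral_reflect_real[where a = 0 and b = 1 and f = "\<lambda>x::real. \<bar>x\<bar> ^ d" and i = "1 / real (Suc d)"] by simp
    with 1 have "((\<lambda>x::real. \<bar>x\<bar> ^ d) has_integral 1 / real (Suc d) + 1 / real (Suc d)) {-1..1}"
      by (intro has_integral_combine[of "-1" 0 1]) auto
    also have "1 / real (Suc d) + 1 / real (Suc d) = 1 / k" by (simp add: k_def field_simps)
    finally have "(\<integral>\<^sup>+v. ennreal (indicator {-1..1} v * \<bar>v\<bar> ^ d) \<partial>lborel) = ennreal (1 / k)"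
      by (rule nn_integral_has_integral_lebesgue[rotated]) simp
    also have "(\<integral>\<^sup>+v. ennreal (indicator {-1..1} v * \<bar>v\<bar> ^ d) \<partial>lborel) = (\<integral>\<^sup>+v\<in>cball 0 1. ennreal (\<bar>v\<bar> ^ d) \<partial>lborel)"
      by (intro nn_integral_cong) (auto split: split_indicator)
    finally show ?thesis .
  qed
  have "(\<integral>\<^sup>+x. ennreal (exp (- (norm x)\<^sup>2)) * ennreal (\<bar>x\<bar> ^ d) \<partial>(lborel :: real measure)) =
      ennreal (k * (1 / k)) * (\<integral>\<^sup>+s\<in>{0<..}. ennreal (exp (- s)) * ennreal (s powr (k - 1)) \<partial>lborel)"
    using k by (intro nn_integral_homogeneous_radial[where d = d and k = k and g = "\<lambda>s. ennreal (exp (- s))", OF _ _ _ _ M])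
      (auto simp: abs_mult power_mult_distrib k_def)
  also have "\<dots> = ennreal (Gamma k)"
    using nn_integral_Gamma_scaled[OF k, of 1] k by (simp add: ennreal_mult')
  finally show ?thesis by (simp add: ennreal_mult' k_def add.commute)
qed

text \<open>For \<open>P\<close> a monomial in the absolute values of the coordinates, the constant in the radial formula
  does not depend on \<open>g\<close> and is read off from the choice \<open>g s = exp (- s)\<close>, for which the left-hand side is a
  product of one-dimensional Gaussian moments and the integral on the right is \<open>Gamma k\<close>.\<close>

lemma nn_integral_abs_monomial_radial:
  fixes e :: "'n::finite \<Rightarrow> nat" and g :: "real \<Rightarrow> ennreal"
  assumes k: "k = (\<Sum>i\<in>UNIV. (real (e i) + 1) / 2)" and g [measurable]: "g \<in> borel_measurable borel"
  shows "(\<integral>\<^sup>+v. g ((norm (v::real^'n))\<^sup>2) * ennreal (\<Prod>i\<in>UNIV. \<bar>v $ i\<bar> ^ e i) \<partial>lborel) =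
    ennreal ((\<Prod>i\<in>UNIV. Gamma ((real (e i) + 1) / 2)) / Gamma k) *
      (\<integral>\<^sup>+s\<in>{0<..}. g s * ennreal (s powr (k - 1)) \<partial>lborel)"
proof -
  define P where "P = (\<lambda>v::real^'n. \<Prod>i\<in>UNIV. \<bar>v $ i\<bar> ^ e i)"
  define G where "G = (\<Prod>i\<in>UNIV. Gamma ((real (e i) + 1) / 2))"
  have cont: "continuous_on S P" for S unfolding P_def by (intro continuous_intros)
  have P [measurable]: "P \<in> borel_measurable borel"
    using cont by (intro borel_measurable_continuous_onI)
  have P_nonneg: "P v \<ge> 0" for v by (simp add: P_def prod_nonneg)
  have k_eq: "k = (DIM(real^'n) + real (\<Sum>i\<in>UNIV. e i)) / 2"
    by (simp add: k sum.distrib sum_divide_distrib[symmetric])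
  have k_pos: "k > 0" unfolding k by (intro sum_pos) auto
  have hom: "P (c *\<^sub>R v) = c ^ (\<Sum>i\<in>UNIV. e i) * P v" if "c > 0" for c v
    using that by (simp add: P_def abs_mult power_mult_distrib prod.distrib power_sum)
  obtain M where M: "(\<integral>\<^sup>+v\<in>cball 0 1. ennreal (P v) \<partial>lborel) = ennreal M" "M \<ge> 0"
  proof -
    have "compact (P ` cball 0 1)"
      by (intro compact_continuous_image cont compact_cball)
    then have "bdd_above (P ` cball 0 1)"
      by (intro bounded_imp_bdd_above compact_imp_bounded)
    then obtain b where b: "\<And>v. v \<in> cball 0 1 \<Longrightarrow> P v \<le> b"
      unfolding bdd_above_def by blast
    have "(\<integral>\<^sup>+v\<in>cball 0 1. ennreal (P v) \<partial>lborel) \<le> (\<integral>\<^sup>+v. ennreal b * indicator (cball (0::real^'n) 1) v \<partial>lborel)"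
      using b by (intro nn_integral_mono) (auto intro: ennreal_leI split: split_indicator)
    also have "\<dots> = ennreal b * emeasure lborel (cball (0::real^'n) 1)"
      by (rule nn_integral_cmult_indicator) simp
    also have "\<dots> < \<infinity>"
      using emeasure_lborel_cball_finite[of "0::real^'n" 1] by (simp add: ennreal_mult_less_top)
    finally have "(\<integral>\<^sup>+v\<in>cball 0 1. ennreal (P v) \<partial>lborel) < \<infinity>" .
    then show ?thesis
      using that[of "enn2real (\<integral>\<^sup>+v\<in>cball 0 1. ennreal (P v) \<partial>lborel)"] by simp
  qed
  note radial = nn_integral_homogeneous_radial[OF P P_nonneg hom k_eq M]
  \<comment> \<open>The radial function \<open>exp (- s)\<close> is a product of functions of the single coordinates,
    which evaluates the unknown constant \<open>k * M\<close>.\<close>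
  have "ennreal G = (\<Prod>b\<in>(Basis :: (real^'n) set). ennreal (Gamma ((real (e (axis_index b)) + 1) / 2)))"
    by (simp add: G_def prod_Basis_vec prod_ennreal Gamma_real_nonneg add_pos_nonneg)
  also have "\<dots> = (\<Prod>b\<in>(Basis :: (real^'n) set). (\<integral>\<^sup>+x. ennreal (exp (- x\<^sup>2) * \<bar>x\<bar> ^ e (axis_index b)) \<partial>lborel))"
    by (simp add: nn_integral_gaussian_moment)
  also have "\<dots> = (\<integral>\<^sup>+v. (\<Prod>b\<in>Basis. ennreal (exp (- (v \<bullet> b)\<^sup>2) * \<bar>v \<bullet> b\<bar> ^ e (axis_index b))) \<partial>(lborel :: (real^'n) measure))"
    by (rule nn_integral_lborel_prod[symmetric]) auto
  also have "\<dots> = (\<integral>\<^sup>+v. ennreal (exp (- (norm (v::real^'n))\<^sup>2)) * ennreal (P v) \<partial>lborel)"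
  proof (rule nn_integral_cong)
    fix v :: "real^'n"
    have "(norm v)\<^sup>2 = (\<Sum>i\<in>UNIV. (v $ i)\<^sup>2)"
      unfolding power2_norm_eq_inner inner_vec_def by (simp add: power2_eq_square)
    then have "exp (- (norm v)\<^sup>2) = (\<Prod>i\<in>UNIV. exp (- (v $ i)\<^sup>2))"
      by (simp only: exp_sum[symmetric] sum_negf finite)
    then have "exp (- (norm v)\<^sup>2) * P v = (\<Prod>i\<in>UNIV. exp (- (v $ i)\<^sup>2) * \<bar>v $ i\<bar> ^ e i)"
      by (simp only: P_def prod.distrib)
    moreover have "(\<Prod>b\<in>Basis. ennreal (exp (- (v \<bullet> b)\<^sup>2) * \<bar>v \<bullet> b\<bar> ^ e (axis_index b))) =
        ennreal (\<Prod>i\<in>UNIV. exp (- (v $ i)\<^sup>2) * \<bar>v $ i\<bar> ^ e i)"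
      by (simp add: prod_Basis_vec prod_ennreal inner_axis)
    ultimately show "(\<Prod>b\<in>Basis. ennreal (exp (- (v \<bullet> b)\<^sup>2) * \<bar>v \<bullet> b\<bar> ^ e (axis_index b))) = ennreal (exp (- (norm v)\<^sup>2)) * ennreal (P v)"
      by (metis ennreal_mult' exp_ge_zero)
  qed
  also have "\<dots> = ennreal (k * M) * (\<integral>\<^sup>+s\<in>{0<..}. ennreal (exp (- s)) * ennreal (s powr (k - 1)) \<partial>lborel)"
    by (rule radial[where g = "\<lambda>s. ennreal (exp (- s))"]) auto
  also have "\<dots> = ennreal (k * M * Gamma k)"
    using nn_integral_Gamma_scaled[OF k_pos, of 1] k_pos M by (simp add: ennreal_mult')
  finally have "G = k * M * Gamma k"
    using k_pos M by (subst (asm) ennreal_inj) (auto simp: G_def intro!: prod_nonneg Gamma_real_nonneg mult_nonneg_nonneg)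
  then have kM: "k * M = G / Gamma k" using Gamma_real_pos[OF k_pos] by simp
  have "(\<integral>\<^sup>+v. g ((norm v)\<^sup>2) * ennreal (P v) \<partial>lborel) =
    ennreal (k * M) * (\<integral>\<^sup>+s\<in>{0<..}. g s * ennreal (s powr (k - 1)) \<partial>lborel)"
    by (rule radial[where g = g]) (assumption, rule g)
  then show ?thesis by (simp only: kM P_def G_def)
qed

text \<open>The moments of the weight \<open>exp (- x\<^sup>2)\<close> on the line; the odd ones vanish by symmetry.\<close>

definition gaussian_moment :: "nat \<Rightarrow> real"
  where "gaussian_moment d = (if even d then Gamma ((real d + 1) / 2) else 0)"

text \<open>If all exponents are even, the monomial is nonnegative and the formula for absolute values applies.
  If the exponent of one coordinate is odd, the integral changes sign under reflection of that coordinate and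
  is therefore zero; the absolute formula still supplies integrability.\<close>

lemma has_bochner_integral_monomial_radial:
  fixes e :: "'n::finite \<Rightarrow> nat" and g :: "real \<Rightarrow> real"
  assumes k: "k = (\<Sum>i\<in>UNIV. (real (e i) + 1) / 2)"
    and g [measurable]: "g \<in> borel_measurable borel" and g_nonneg: "\<And>s. g s \<ge> 0"
    and L: "(\<integral>\<^sup>+s\<in>{0<..}. ennreal (g s * s powr (k - 1)) \<partial>lborel) = ennreal (Gamma k * L)" "L \<ge> 0"
  shows "has_bochner_integral lborel (\<lambda>v::real^'n. g ((norm v)\<^sup>2) * (\<Prod>i\<in>UNIV. (v $ i) ^ e i))
    (L * (\<Prod>i\<in>UNIV. gaussian_moment (e i)))"
proof -
  let ?f = "\<lambda>v::real^'n. g ((norm v)\<^sup>2) * (\<Prod>i\<in>UNIV. (v $ i) ^ e i)"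
  define G where "G = (\<Prod>i\<in>UNIV. Gamma ((real (e i) + 1) / 2))"
  have G_nonneg: "G \<ge> 0" by (auto simp: G_def intro!: prod_nonneg Gamma_real_nonneg)
  have k_pos: "k > 0" unfolding k by (intro sum_pos) auto
  have [measurable]: "(\<lambda>v::real^'n. \<Prod>i\<in>UNIV. (v $ i) ^ e i) \<in> borel_measurable borel"
    by (intro borel_measurable_continuous_onI continuous_intros)
  have abs: "(\<integral>\<^sup>+v. ennreal \<bar>?f v\<bar> \<partial>lborel) = ennreal (L * G)"
  proof -
    have "(\<integral>\<^sup>+v. ennreal \<bar>?f v\<bar> \<partial>lborel) =
        (\<integral>\<^sup>+v. ennreal (g ((norm (v::real^'n))\<^sup>2)) * ennreal (\<Prod>i\<in>UNIV. \<bar>v $ i\<bar> ^ e i) \<partial>lborel)"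
      by (simp add: abs_mult g_nonneg ennreal_mult' abs_prod power_abs)
    also have "\<dots> = ennreal (G / Gamma k) * (\<integral>\<^sup>+s\<in>{0<..}. ennreal (g s) * ennreal (s powr (k - 1)) \<partial>lborel)"
      unfolding G_def by (rule nn_integral_abs_monomial_radial[OF k]) auto
    also have "\<dots> = ennreal (L * G)"
      using L G_nonneg Gamma_real_pos[OF k_pos] by (simp add: ennreal_mult'[symmetric] g_nonneg)
    finally show ?thesis .
  qed
  show ?thesis
  proof (cases "\<forall>i. even (e i)")
    case True
    have "has_bochner_integral lborel ?f (L * G)"
    proof (rule has_bochner_integral_nn_integral)
      show "AE v in lborel. 0 \<le> ?f v"
        using True g_nonneg by (auto intro!: AE_I2 mult_nonneg_nonneg prod_nonneg zero_le_even_power)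
      show "(\<integral>\<^sup>+v. ennreal (?f v) \<partial>lborel) = ennreal (L * G)"
        unfolding abs[symmetric] using True g_nonneg
        by (intro nn_integral_cong) (simp add: abs_mult abs_prod power_abs power_even_abs)
    qed (use L G_nonneg in auto)
    with True show ?thesis by (simp add: G_def gaussian_moment_def)
  next
    case False
    then obtain i where i: "odd (e i)" by blast
    have "integrable lborel ?f"
      using abs by (intro integrableI_bounded) auto
    then have I: "has_bochner_integral lborel ?f (integral\<^sup>L lborel ?f)"
      by (rule has_bochner_integral_integrable)
    \<comment> \<open>Reflecting the \<open>i\<close>-th coordinate preserves the measure and the norm but flips the sign.\<close>
    define R :: "real^'n^'n" where "R = (\<chi> a b. if a = b then if a = i then -1 else 1 else 0)"
    have R: "R *v v = (\<chi> a. if a = i then - v $ a else v $ a)" for v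
    proof -
      have "(\<Sum>b\<in>UNIV. (if a = b then if a = i then -1 else 1 else 0) * v $ b) = (if a = i then - v $ a else v $ a)" for a
      proof -
        have "(\<Sum>b\<in>UNIV. (if a = b then if a = i then -1 else 1 else 0) * v $ b) =
            (\<Sum>b\<in>UNIV. if a = b then if a = i then - v $ b else v $ b else 0)"
          by (intro sum.cong) auto
        then show ?thesis by simp
      qed
      then show ?thesis by (simp add: R_def matrix_vector_mult_def vec_eq_iff)
    qed
    have "det R = (\<Prod>a\<in>UNIV. R $ a $ a)" by (rule det_diagonal) (simp add: R_def)
    also have "\<dots> = (\<Prod>a\<in>UNIV. if a = i then -1 else 1)" by (simp add: R_def)
    finally have det: "det R = -1" by simp
    have norm: "norm (R *v v) = norm v" for v
      unfolding norm_vec_def R by (intro arg_cong2[where f = L2_set] refl ext) auto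
    have flip: "?f (R *v v) = - ?f v" for v
    proof -
      have "(\<Prod>a\<in>UNIV. (R *v v) $ a ^ e a) = (R *v v) $ i ^ e i * (\<Prod>a\<in>UNIV - {i}. (R *v v) $ a ^ e a)"
        by (rule prod.remove) auto
      also have "(\<Prod>a\<in>UNIV - {i}. (R *v v) $ a ^ e a) = (\<Prod>a\<in>UNIV - {i}. v $ a ^ e a)"
        by (intro prod.cong) (auto simp: R)
      also have "(R *v v) $ i ^ e i = - (v $ i ^ e i)"
        using i by (simp add: R)
      finally have "(\<Prod>a\<in>UNIV. (R *v v) $ a ^ e a) = - (\<Prod>a\<in>UNIV. v $ a ^ e a)"
        by (simp add: prod.remove[of UNIV i])
      then show ?thesis by (simp add: norm)
    qed
    have "has_bochner_integral lborel (\<lambda>v. \<bar>det R\<bar> * ?f (R *v v)) (- integral\<^sup>L lborel ?f)"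
      unfolding flip det using has_bochner_integral_minus[OF I] by simp
    then have "has_bochner_integral lborel ?f (- integral\<^sup>L lborel ?f)"
      by (rule has_bochner_integral_lborel_linear[rotated 2]) (auto simp: det)
    from has_bochner_integral_eq[OF this I] have "integral\<^sup>L lborel ?f = 0"
      by linarith
    moreover have "(\<Prod>i\<in>UNIV. gaussian_moment (e i)) = 0"
      using i by (auto simp: gaussian_moment_def)
    ultimately show ?thesis using I by (simp only: mult_zero_right)
  qed
qed

text \<open>Dividing the radial integral by \<open>Gamma k\<close> removes the constant that comes from the angular part: for a
  monomial of degree \<open>d\<close> and \<open>k = (n + d) / 2\<close>, the integral over \<open>n\<close>-space is \<open>L\<close> times a product of Gaussian
  moments.\<close>

definition has_radial_moment :: "(real \<Rightarrow> real) \<Rightarrow> real \<Rightarrow> real \<Rightarrow> bool"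
  where "has_radial_moment g k L \<longleftrightarrow> L \<ge> 0 \<and>
    (\<integral>\<^sup>+s\<in>{0<..}. ennreal (g s * s powr (k - 1)) \<partial>lborel) = ennreal (Gamma k * L)"

lemma gaussian_moment_values:
  "gaussian_moment 0 = sqrt pi" "gaussian_moment 2 = sqrt pi / 2" "gaussian_moment 4 = sqrt pi * 3 / 4"
proof -
  show "gaussian_moment 0 = sqrt pi" by (simp add: gaussian_moment_def Gamma_one_half_real)
  have "Gamma (1 / 2 + 1 :: real) = 1 / 2 * Gamma (1 / 2)"
    by (rule Gamma_plus1) auto
  then have 2: "Gamma (3 / 2 :: real) = sqrt pi / 2" by (simp add: Gamma_one_half_real)
  then show "gaussian_moment 2 = sqrt pi / 2" by (simp add: gaussian_moment_def)
  have "Gamma (3 / 2 + 1 :: real) = 3 / 2 * Gamma (3 / 2)"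
    by (rule Gamma_plus1) auto
  then show "gaussian_moment 4 = sqrt pi * 3 / 4" using 2 by (simp add: gaussian_moment_def)
qed

text \<open>Coordinates that do not occur in \<open>xs\<close> contribute the Gaussian normalisation \<open>sqrt pi\<close> each.\<close>

lemma prod_gaussian_moment_count:
  "(\<Prod>m\<in>UNIV. gaussian_moment (count_list xs (m::'n::finite))) =
    pi powr (real CARD('n) / 2) * (\<Prod>m\<in>set xs. gaussian_moment (count_list xs m) / sqrt pi)"
proof -
  have "(\<Prod>m\<in>UNIV. gaussian_moment (count_list xs m)) = (\<Prod>m\<in>(UNIV::'n set). sqrt pi * (gaussian_moment (count_list xs m) / sqrt pi))"
    by simp
  also have "\<dots> = sqrt pi ^ CARD('n) * (\<Prod>m\<in>UNIV. gaussian_moment (count_list xs m) / sqrt pi)"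
    by (simp only: prod.distrib prod_constant)
  also have "(\<Prod>m\<in>(UNIV::'n set). gaussian_moment (count_list xs m) / sqrt pi) = (\<Prod>m\<in>set xs. gaussian_moment (count_list xs m) / sqrt pi)"
    by (rule prod.mono_neutral_right) (auto simp: count_notin gaussian_moment_values)
  also have "sqrt pi ^ CARD('n) = pi powr (real CARD('n) / 2)"
    by (simp add: powr_half_sqrt[symmetric] powr_realpow[symmetric] powr_powr)
  finally show ?thesis .
qed

text \<open>Monomials written as a product over a list of indices, the form in which they arise when linear and
  quadratic forms are multiplied out.\<close>

lemma has_bochner_integral_word_radial:
  fixes g :: "real \<Rightarrow> real" and xs :: "'n::finite list"
  assumes g: "g \<in> borel_measurable borel" "\<And>s. g s \<ge> 0"
    and L: "has_radial_moment g ((real CARD('n) + length xs) / 2) L"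
  shows "has_bochner_integral lborel (\<lambda>v::real^'n. g ((norm v)\<^sup>2) * (\<Prod>i\<leftarrow>xs. v $ i))
    (L * (\<Prod>m\<in>UNIV. gaussian_moment (count_list xs m)))"
proof -
  have "(\<Sum>m\<in>UNIV. count_list xs m) = length xs"
    using sum_count_set[of xs UNIV] by simp
  then have k: "(real CARD('n) + length xs) / 2 = (\<Sum>m\<in>UNIV. (real (count_list xs m) + 1) / 2)"
    by (simp add: sum_divide_distrib[symmetric] sum.distrib of_nat_sum[symmetric] del: of_nat_sum)
  have "(\<Prod>i\<leftarrow>xs. v $ i) = (\<Prod>m\<in>UNIV. v $ m ^ count_list xs m)" for v :: "real^'n"
  proof (induction xs)
    case (Cons a xs)
    have "(\<Prod>m\<in>UNIV. v $ m ^ count_list (a # xs) m) = (\<Prod>m\<in>UNIV. (if m = a then v $ m else 1) * v $ m ^ count_list xs m)"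
      by (intro prod.cong) auto
    then show ?case using Cons by (simp add: prod.distrib)
  qed simp
  then show ?thesis
    using has_bochner_integral_monomial_radial[OF k g, of L] L by (simp add: has_radial_moment_def)
qed

lemma radial_moment_odd:
  fixes g :: "real \<Rightarrow> real" and xs :: "'n::finite list"
  assumes g: "g \<in> borel_measurable borel" "\<And>s. g s \<ge> 0"
    and L: "has_radial_moment g ((real CARD('n) + length xs) / 2) L" and odd: "odd (length xs)"
  shows "has_bochner_integral lborel (\<lambda>v::real^'n. g ((norm v)\<^sup>2) * (\<Prod>i\<leftarrow>xs. v $ i)) 0"
proof -
  have "(\<Sum>m\<in>UNIV. count_list xs m) = length xs"
    using sum_count_set[of xs UNIV] by simp
  with odd obtain m where "odd (count_list xs m)"
    by (metis dvd_sum)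
  then have "(\<Prod>m\<in>UNIV. gaussian_moment (count_list xs m)) = 0"
    by (auto simp: gaussian_moment_def intro!: prod_zero)
  then show ?thesis using has_bochner_integral_word_radial[OF g L] by (simp only: mult_zero_right)
qed

lemma radial_moment_2:
  fixes g :: "real \<Rightarrow> real" and i j :: "'n::finite"
  assumes g: "g \<in> borel_measurable borel" "\<And>s. g s \<ge> 0"
    and L: "has_radial_moment g (real CARD('n) / 2 + 1) L"
  shows "has_bochner_integral lborel (\<lambda>v::real^'n. g ((norm v)\<^sup>2) * (v $ i * v $ j))
    (L * pi powr (real CARD('n) / 2) / 2 * of_bool (i = j))"
proof -
  have "has_bochner_integral lborel (\<lambda>v::real^'n. g ((norm v)\<^sup>2) * (\<Prod>i\<leftarrow>[i, j]. v $ i))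
    (L * (\<Prod>m\<in>UNIV. gaussian_moment (count_list [i, j] m)))"
    using L by (intro has_bochner_integral_word_radial g) (simp add: add_divide_distrib)
  moreover have "(\<Prod>m\<in>set [i, j]. gaussian_moment (count_list [i, j] m) / sqrt pi) = 1 / 2 * of_bool (i = j)"
    by (cases "i = j") (auto simp: gaussian_moment_values gaussian_moment_def[of "Suc 0"] numeral_2_eq_2[symmetric])
  ultimately show ?thesis by (simp only: prod_gaussian_moment_count) (simp add: algebra_simps)
qed

text \<open>The analogue of Wick's formula: a sum over the three pairings of the four indices. When all indices
  coincide, the pairings add up to the normalised fourth Gaussian moment \<open>3 / 4\<close>.\<close>

lemma radial_moment_4:
  fixes g :: "real \<Rightarrow> real" and i j k l :: "'n::finite"
  assumes g: "g \<in> borel_measurable borel" "\<And>s. g s \<ge> 0"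
    and L: "has_radial_moment g (real CARD('n) / 2 + 2) L"
  shows "has_bochner_integral lborel (\<lambda>v::real^'n. g ((norm v)\<^sup>2) * (v $ i * v $ j * v $ k * v $ l))
    (L * pi powr (real CARD('n) / 2) / 4 *
      (of_bool (i = j \<and> k = l) + of_bool (i = k \<and> j = l) + of_bool (i = l \<and> j = k)))"
proof -
  have "has_bochner_integral lborel (\<lambda>v::real^'n. g ((norm v)\<^sup>2) * (\<Prod>i\<leftarrow>[i, j, k, l]. v $ i))
    (L * (\<Prod>m\<in>UNIV. gaussian_moment (count_list [i, j, k, l] m)))"
    using L by (intro has_bochner_integral_word_radial g) (simp add: add_divide_distrib)
  moreover have "(\<Prod>m\<in>set [i, j, k, l]. gaussian_moment (count_list [i, j, k, l] m) / sqrt pi) =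
    1 / 4 * (of_bool (i = j \<and> k = l) + of_bool (i = k \<and> j = l) + of_bool (i = l \<and> j = k))"
  proof -
    have v: "gaussian_moment (Suc 0) = 0" "gaussian_moment (Suc (Suc 0)) = sqrt pi / 2"
      "gaussian_moment (Suc (Suc (Suc 0))) = 0" "gaussian_moment (Suc (Suc (Suc (Suc 0)))) = sqrt pi * 3 / 4"
      using gaussian_moment_values by (simp_all add: numeral_eq_Suc) (simp_all add: gaussian_moment_def)
    show ?thesis
      by (cases "i = j"; cases "i = k"; cases "i = l"; cases "j = k"; cases "j = l"; cases "k = l") (simp_all add: v insert_commute)
  qed
  ultimately show ?thesis by (simp only: prod_gaussian_moment_count) (simp add: algebra_simps)
qed

section \<open>Moments of linear and quadratic forms under radial weights\<close>

lemma quadratic_form_expand: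
  fixes X :: "real^'n^'n"
  shows "v \<bullet> (X *v w) = (\<Sum>i\<in>UNIV. \<Sum>j\<in>UNIV. X $ i $ j * (v $ i * w $ j))"
  by (simp add: inner_vec_def matrix_vector_mult_def sum_distrib_left mult_ac)

lemma radial_linear_moment:
  fixes g :: "real \<Rightarrow> real" and x :: "real^'n"
  assumes g: "g \<in> borel_measurable borel" "\<And>s. g s \<ge> 0"
    and L: "has_radial_moment g (real CARD('n) / 2 + 1 / 2) L"
  shows "has_bochner_integral lborel (\<lambda>v::real^'n. g ((norm v)\<^sup>2) * (x \<bullet> v)) 0"
proof -
  have "has_bochner_integral lborel (\<lambda>v::real^'n. \<Sum>i\<in>UNIV. x $ i * (g ((norm v)\<^sup>2) * (\<Prod>i\<leftarrow>[i]. v $ i))) (\<Sum>i\<in>UNIV. x $ i * 0)"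
    using L by (intro has_bochner_integral_sum has_bochner_integral_mult_right radial_moment_odd g) (simp_all add: add_divide_distrib)
  then show ?thesis by (simp add: inner_vec_def sum_distrib_left mult_ac)
qed

lemma radial_cubic_moment:
  fixes g :: "real \<Rightarrow> real" and x :: "real^'n" and X :: "real^'n^'n"
  assumes g: "g \<in> borel_measurable borel" "\<And>s. g s \<ge> 0"
    and L: "has_radial_moment g (real CARD('n) / 2 + 3 / 2) L"
  shows "has_bochner_integral lborel (\<lambda>v::real^'n. g ((norm v)\<^sup>2) * ((v \<bullet> (X *v v)) * (x \<bullet> v))) 0"
proof -
  have "has_bochner_integral lborel (\<lambda>v::real^'n. \<Sum>i\<in>UNIV. \<Sum>j\<in>UNIV. \<Sum>k\<in>UNIV. (X $ i $ j * x $ k) * (g ((norm v)\<^sup>2) * (\<Prod>i\<leftarrow>[i,j,k]. v $ i)))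
    (\<Sum>i\<in>UNIV. \<Sum>j\<in>UNIV. \<Sum>k\<in>UNIV. (X $ i $ j * x $ k) * 0)"
    using L by (intro has_bochner_integral_sum has_bochner_integral_mult_right radial_moment_odd g) (simp_all add: add_divide_distrib)
  then show ?thesis
    unfolding quadratic_form_expand unfolding inner_vec_def
    by (simp only: sum_distrib_right) (simp add: sum_distrib_left mult_ac)
qed

lemma radial_bilinear_moment:
  fixes g :: "real \<Rightarrow> real" and x y :: "real^'n"
  assumes g: "g \<in> borel_measurable borel" "\<And>s. g s \<ge> 0"
    and L: "has_radial_moment g (real CARD('n) / 2 + 1) L"
  shows "has_bochner_integral lborel (\<lambda>v::real^'n. g ((norm v)\<^sup>2) * ((x \<bullet> v) * (y \<bullet> v)))
    (L * pi powr (real CARD('n) / 2) / 2 * (x \<bullet> y))"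
proof -
  let ?C = "L * pi powr (real CARD('n) / 2) / 2"
  have "has_bochner_integral lborel (\<lambda>v::real^'n. \<Sum>i\<in>UNIV. \<Sum>j\<in>UNIV. (x $ i * y $ j) * (g ((norm v)\<^sup>2) * (v $ i * v $ j)))
    (\<Sum>i\<in>UNIV. \<Sum>j\<in>UNIV. (x $ i * y $ j) * (?C * of_bool (i = j)))"
    using L by (intro has_bochner_integral_sum has_bochner_integral_mult_right radial_moment_2 g)
  also have "(\<lambda>v::real^'n. \<Sum>i\<in>UNIV. \<Sum>j\<in>UNIV. (x $ i * y $ j) * (g ((norm v)\<^sup>2) * (v $ i * v $ j))) =
      (\<lambda>v. g ((norm v)\<^sup>2) * ((x \<bullet> v) * (y \<bullet> v)))"
    unfolding inner_vec_def by (simp only: sum_distrib_right) (simp add: sum_distrib_left mult_ac)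
  also have "(\<Sum>i\<in>UNIV. \<Sum>j\<in>UNIV. (x $ i * y $ j) * (?C * of_bool (i = j))) = ?C * (x \<bullet> y)"
    by (simp add: inner_vec_def sum_distrib_left of_bool_def if_distrib mult_ac cong: if_cong)
  finally show ?thesis .
qed

lemma radial_quadratic_moment:
  fixes g :: "real \<Rightarrow> real" and X :: "real^'n^'n"
  assumes g: "g \<in> borel_measurable borel" "\<And>s. g s \<ge> 0"
    and L: "has_radial_moment g (real CARD('n) / 2 + 1) L"
  shows "has_bochner_integral lborel (\<lambda>v::real^'n. g ((norm v)\<^sup>2) * (v \<bullet> (X *v v)))
    (L * pi powr (real CARD('n) / 2) / 2 * trace X)"
proof -
  let ?C = "L * pi powr (real CARD('n) / 2) / 2"
  have "has_bochner_integral lborel (\<lambda>v::real^'n. \<Sum>i\<in>UNIV. \<Sum>j\<in>UNIV. X $ i $ j * (g ((norm v)\<^sup>2) * (v $ i * v $ j)))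
    (\<Sum>i\<in>UNIV. \<Sum>j\<in>UNIV. X $ i $ j * (?C * of_bool (i = j)))"
    using L by (intro has_bochner_integral_sum has_bochner_integral_mult_right radial_moment_2 g)
  also have "(\<lambda>v::real^'n. \<Sum>i\<in>UNIV. \<Sum>j\<in>UNIV. X $ i $ j * (g ((norm v)\<^sup>2) * (v $ i * v $ j))) =
      (\<lambda>v. g ((norm v)\<^sup>2) * (v \<bullet> (X *v v)))"
    unfolding quadratic_form_expand by (simp add: sum_distrib_left mult_ac fun_eq_iff)
  also have "(\<Sum>i\<in>UNIV. \<Sum>j\<in>UNIV. X $ i $ j * (?C * of_bool (i = j))) = ?C * trace X"
    by (simp add: trace_def sum_distrib_left sum_distrib_right of_bool_def if_distrib mult_ac cong: if_cong)
  finally show ?thesis .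
qed

text \<open>The pairing within the two forms gives the product of the traces; each of the two pairings
  across them gives \<open>trace (X ** Y)\<close>, one of them only because \<open>Y\<close> is symmetric.\<close>

lemma radial_quartic_moment:
  fixes g :: "real \<Rightarrow> real" and X Y :: "real^'n^'n"
  assumes g: "g \<in> borel_measurable borel" "\<And>s. g s \<ge> 0"
    and L: "has_radial_moment g (real CARD('n) / 2 + 2) L" and Y: "transpose Y = Y"
  shows "has_bochner_integral lborel (\<lambda>v::real^'n. g ((norm v)\<^sup>2) * ((v \<bullet> (X *v v)) * (v \<bullet> (Y *v v))))
    (L * pi powr (real CARD('n) / 2) / 4 * (trace X * trace Y + 2 * trace (X ** Y)))"
proof -
  let ?C = "L * pi powr (real CARD('n) / 2) / 4"
  let ?\<delta> = "\<lambda>i j k l. of_bool (i = j \<and> k = l) + of_bool (i = k \<and> j = l) + of_bool (i = l \<and> j = k) :: real"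
  have sym: "Y $ i $ j = Y $ j $ i" for i j
    using Y by (metis transpose_def vec_lambda_beta)
  have "has_bochner_integral lborel (\<lambda>v::real^'n. \<Sum>i\<in>UNIV. \<Sum>j\<in>UNIV. \<Sum>k\<in>UNIV. \<Sum>l\<in>UNIV.
        (X $ i $ j * Y $ k $ l) * (g ((norm v)\<^sup>2) * (v $ i * v $ j * v $ k * v $ l)))
    (\<Sum>i\<in>UNIV. \<Sum>j\<in>UNIV. \<Sum>k\<in>UNIV. \<Sum>l\<in>UNIV. (X $ i $ j * Y $ k $ l) * (?C * ?\<delta> i j k l))"
    using L by (intro has_bochner_integral_sum has_bochner_integral_mult_right radial_moment_4 g)
  also have "(\<lambda>v::real^'n. \<Sum>i\<in>UNIV. \<Sum>j\<in>UNIV. \<Sum>k\<in>UNIV. \<Sum>l\<in>UNIV.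
        (X $ i $ j * Y $ k $ l) * (g ((norm v)\<^sup>2) * (v $ i * v $ j * v $ k * v $ l))) =
      (\<lambda>v. g ((norm v)\<^sup>2) * ((v \<bullet> (X *v v)) * (v \<bullet> (Y *v v))))"
    unfolding quadratic_form_expand by (simp only: sum_distrib_right) (simp add: sum_distrib_left mult_ac)
  also have "(\<Sum>i\<in>UNIV. \<Sum>j\<in>UNIV. \<Sum>k\<in>UNIV. \<Sum>l\<in>UNIV. (X $ i $ j * Y $ k $ l) * (?C * ?\<delta> i j k l)) =
      ?C * (trace X * trace Y + 2 * trace (X ** Y))"
  proof -
    have delta: "(\<Sum>k\<in>UNIV. \<Sum>l\<in>UNIV. if k = a then if l = b then Y $ k $ l else 0 else 0) = Y $ a $ b" for a b
    proof -
      have "(\<Sum>k\<in>UNIV. \<Sum>l\<in>UNIV. if k = a then if l = b then Y $ k $ l else 0 else 0) =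
          (\<Sum>k\<in>UNIV. if k = a then \<Sum>l\<in>UNIV. if l = b then Y $ k $ l else 0 else 0)"
        by (intro sum.cong) auto
      then show ?thesis by simp
    qed
    have inner: "(\<Sum>k\<in>UNIV. \<Sum>l\<in>UNIV. (X $ i $ j * Y $ k $ l) * (?C * ?\<delta> i j k l)) =
        ?C * (X $ i $ j * (of_bool (i = j) * trace Y + 2 * Y $ j $ i))" for i j
    proof -
      have "(\<Sum>k\<in>UNIV. \<Sum>l\<in>UNIV. (X $ i $ j * Y $ k $ l) * (?C * ?\<delta> i j k l)) =
          ?C * (X $ i $ j * (\<Sum>k\<in>UNIV. \<Sum>l\<in>UNIV. (if k = l then of_bool (i = j) * Y $ k $ l else 0) +
            (if k = i then if l = j then Y $ k $ l else 0 else 0) + (if k = j then if l = i then Y $ k $ l else 0 else 0)))"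
        by (simp only: sum_distrib_left) (intro sum.cong refl; auto)
      also have "(\<Sum>k\<in>UNIV. \<Sum>l\<in>UNIV. (if k = l then of_bool (i = j) * Y $ k $ l else 0) +
            (if k = i then if l = j then Y $ k $ l else 0 else 0) + (if k = j then if l = i then Y $ k $ l else 0 else 0)) =
          of_bool (i = j) * trace Y + Y $ i $ j + Y $ j $ i"
        by (simp add: sum.distrib trace_def sum_distrib_left delta)
      finally show ?thesis using sym[of i j] by simp
    qed
    have trXY: "trace (X ** Y) = (\<Sum>i\<in>UNIV. \<Sum>j\<in>UNIV. X $ i $ j * Y $ j $ i)"
      by (simp add: trace_def matrix_matrix_mult_def)
    have trX: "(\<Sum>i\<in>UNIV. X $ i $ i * trace Y) = trace X * trace Y"
      by (simp add: trace_def[of X] sum_distrib_right)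
    have "(\<Sum>i\<in>UNIV. \<Sum>j\<in>UNIV. ?C * (X $ i $ j * (of_bool (i = j) * trace Y + 2 * Y $ j $ i))) =
       ?C * (\<Sum>i\<in>UNIV. \<Sum>j\<in>UNIV. (if i = j then X $ i $ j * trace Y else 0) + 2 * (X $ i $ j * Y $ j $ i))"
      by (simp only: sum_distrib_left) (intro sum.cong refl; simp add: algebra_simps)
    also have "(\<Sum>i\<in>UNIV. \<Sum>j\<in>UNIV. (if i = j then X $ i $ j * trace Y else 0) + 2 * (X $ i $ j * Y $ j $ i)) =
       trace X * trace Y + 2 * trace (X ** Y)"
      by (simp add: sum.distrib trX trXY sum_distrib_left)
    finally show ?thesis unfolding inner .
  qed
  finally show ?thesis .
qed

section \<open>Radial integrals of the generalized Gaussian profiles\<close>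

text \<open>Cutting off where the base is not positive covers bounded and unbounded supports by one formula.\<close>

definition base_profile :: "real \<Rightarrow> real \<Rightarrow> real \<Rightarrow> real"
  where "base_profile c a s = (if 1 + c * s > 0 then (1 + c * s) powr a else 0)"

lemma base_profile_nonneg: "base_profile c a s \<ge> 0"
  by (simp add: base_profile_def)

lemma borel_measurable_base_profile [measurable]: "base_profile c a \<in> borel_measurable borel"
  unfolding base_profile_def by measurable

lemma has_radial_moment_cmult:
  assumes L: "has_radial_moment g k L" and A: "A \<ge> 0" and [measurable]: "g \<in> borel_measurable borel"
  shows "has_radial_moment (\<lambda>s. A * g s) k (A * L)"
proof -
  have "(\<integral>\<^sup>+s\<in>{0<..}. ennreal (A * g s * s powr (k - 1)) \<partial>lborel) =
      (\<integral>\<^sup>+s. ennreal A * (ennreal (g s * s powr (k - 1)) * indicator {0<..} s) \<partial>lborel)"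
    using A by (simp add: ennreal_mult' mult.assoc)
  also have "\<dots> = ennreal A * (\<integral>\<^sup>+s\<in>{0<..}. ennreal (g s * s powr (k - 1)) \<partial>lborel)"
    by (rule nn_integral_cmult) measurable
  also have "\<dots> = ennreal (Gamma k * (A * L))"
    using L A by (simp add: has_radial_moment_def ennreal_mult'[symmetric] mult_ac)
  finally show ?thesis using L A by (simp add: has_radial_moment_def)
qed

lemma has_radial_moment_exp:
  assumes k: "k > 0" 
  shows "has_radial_moment (\<lambda>s. exp (- (s / 2))) k (2 powr k)"
proof -
  have "(\<integral>\<^sup>+s\<in>{0<..}. ennreal (exp (- (1 / 2 * s)) * s powr (k - 1)) \<partial>lborel) = ennreal (Gamma k / (1 / 2) powr k)"
    using k by (intro nn_integral_Gamma_scaled) auto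
  moreover have "(1 / 2 :: real) powr k = 1 / 2 powr k" by (simp add: powr_divide)
  ultimately show ?thesis by (simp add: has_radial_moment_def)
qed

text \<open>For \<open>c < 0\<close> the substitution \<open>t = - c * s\<close> produces the Beta integral over the unit interval.\<close>

lemma has_radial_moment_base_profile_compact:
  assumes c: "c < 0" and k: "k > 0" and a: "a > -1"
  shows "has_radial_moment (base_profile c a) k ((- c) powr (- k) * Gamma (a + 1) / Gamma (a + 1 + k))"
proof -
  have "ennreal (Beta k (a + 1)) = (\<integral>\<^sup>+t. ennreal (indicator {0..1} t * (t powr (k - 1) * (1 - t) powr (a + 1 - 1))) \<partial>lborel)"
    using k a by (intro nn_integral_has_integral_lebesgue[symmetric] has_integral_Beta_real) auto
  also have "\<dots> = ennreal (- c) * (\<integral>\<^sup>+s. ennreal (indicator {0..1} (- c * s) * ((- c * s) powr (k - 1) * (1 - (- c * s)) powr (a + 1 - 1))) \<partial>lborel)"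
    using c by (subst nn_integral_real_affine[where c = "- c" and t = 0]) auto
  also have "\<dots> = (\<integral>\<^sup>+s. ennreal (- c) * ennreal (indicator {0..1} (- c * s) * ((- c * s) powr (k - 1) * (1 - (- c * s)) powr (a + 1 - 1))) \<partial>lborel)"
    by (rule nn_integral_cmult[symmetric]) measurable
  also have "\<dots> = (\<integral>\<^sup>+s. ennreal ((- c) powr k) * (ennreal (base_profile c a s * s powr (k - 1)) * indicator {0<..} s) \<partial>lborel)"
  proof (rule nn_integral_cong)
    fix s :: real
    have "- c * (indicator {0..1} (- c * s) * ((- c * s) powr (k - 1) * (1 - (- c * s)) powr (a + 1 - 1)))
       = (- c) powr k * (base_profile c a s * s powr (k - 1) * indicator {0<..} s)"
    proof (cases "0 < s \<and> 0 < 1 + c * s")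
      case True
      have mult: "(- c * s) powr (k - 1) = (- c) powr (k - 1) * s powr (k - 1)" by (rule powr_mult)
      have "- c * s \<in> {0..1}" using True c by (auto simp: mult_nonpos_nonneg)
      then have "- c * (indicator {0..1} (- c * s) * ((- c * s) powr (k - 1) * (1 - (- c * s)) powr (a + 1 - 1)))
          = (- c * (- c) powr (k - 1)) * (base_profile c a s * s powr (k - 1) * indicator {0<..} s)"
        using True unfolding mult by (simp add: base_profile_def mult_ac)
      also have "- c * (- c) powr (k - 1) = (- c) powr k" using c powr_mult_base[of "- c" "k - 1"] by simp
      finally show ?thesis .
    next
      case False
      then consider "s \<le> 0" | "s > 0" "1 + c * s \<le> 0" by linarith
      then show ?thesis
      proof cases
        case 1
        then have "- c * s \<le> 0" using c by (simp add: mult_nonpos_nonpos)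
        with 1 show ?thesis by (auto simp: indicator_def)
      next
        case 2
        then show ?thesis by (cases "1 + c * s = 0") (auto simp: base_profile_def indicator_def)
      qed
    qed
    then have "ennreal (- c) * ennreal (indicator {0..1} (- c * s) * ((- c * s) powr (k - 1) * (1 - (- c * s)) powr (a + 1 - 1))) =
        ennreal ((- c) powr k * (base_profile c a s * s powr (k - 1) * indicator {0<..} s))"
      using c by (subst ennreal_mult'[symmetric]) simp_all
    also have "\<dots> = ennreal ((- c) powr k) * (ennreal (base_profile c a s * s powr (k - 1)) * indicator {0<..} s)"
      by (subst ennreal_mult') (auto split: split_indicator)
    finally show "ennreal (- c) * ennreal (indicator {0..1} (- c * s) * ((- c * s) powr (k - 1) * (1 - (- c * s)) powr (a + 1 - 1))) =
      ennreal ((- c) powr k) * (ennreal (base_profile c a s * s powr (k - 1)) * indicator {0<..} s)" .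
  qed
  also have "\<dots> = ennreal ((- c) powr k) * (\<integral>\<^sup>+s\<in>{0<..}. ennreal (base_profile c a s * s powr (k - 1)) \<partial>lborel)"
    by (rule nn_integral_cmult) measurable
  finally have "ennreal (Beta k (a + 1)) = ennreal ((- c) powr k) * (\<integral>\<^sup>+s\<in>{0<..}. ennreal (base_profile c a s * s powr (k - 1)) \<partial>lborel)" .
  then have "ennreal ((- c) powr (- k)) * ennreal (Beta k (a + 1)) = (ennreal ((- c) powr (- k)) * ennreal ((- c) powr k)) * (\<integral>\<^sup>+s\<in>{0<..}. ennreal (base_profile c a s * s powr (k - 1)) \<partial>lborel)"
    by (simp only: mult.assoc)
  also have "ennreal ((- c) powr (- k)) * ennreal ((- c) powr k) = 1"
    using c by (simp add: ennreal_mult'[symmetric] powr_add[symmetric])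
  finally have "(\<integral>\<^sup>+s\<in>{0<..}. ennreal (base_profile c a s * s powr (k - 1)) \<partial>lborel) = ennreal ((- c) powr (- k) * Beta k (a + 1))"
    by (simp add: ennreal_mult')
  moreover have "(- c) powr (- k) * Beta k (a + 1) = Gamma k * ((- c) powr (- k) * Gamma (a + 1) / Gamma (a + 1 + k))"
    by (simp add: Beta_def add_ac)
  moreover have "(- c) powr (- k) * Gamma (a + 1) / Gamma (a + 1 + k) \<ge> 0"
    using k a by (intro divide_nonneg_nonneg mult_nonneg_nonneg Gamma_real_nonneg) auto
  ultimately show ?thesis by (simp add: has_radial_moment_def)
qed

text \<open>For \<open>c > 0\<close> the profile is a mixture of exponentials, since \<open>Gamma b * (1 + c * s) powr (- b)\<close> is the
  integral of \<open>exp (- ((1 + c * s) * t)) * t powr (b - 1)\<close> over \<open>t > 0\<close>. Interchanging the two integrations leaves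
  Gamma integrals only. The condition \<open>b > k\<close> is exactly integrability at infinity.\<close>

lemma has_radial_moment_base_profile_heavy:
  assumes c: "c > 0" and k: "k > 0" and b: "b > k"
  shows "has_radial_moment (base_profile c (- b)) k (c powr (- k) * Gamma (b - k) / Gamma b)"
proof -
  have b_pos: "b > 0" using b k by simp
  \<comment> \<open>\<open>?h\<close> integrates over \<open>t\<close> to \<open>Gamma b\<close> times the integrand and over \<open>s\<close> to a multiple of a Gamma density in \<open>t\<close>.\<close>
  let ?h = "\<lambda>s t. ennreal (exp (- ((1 + c * s) * t)) * t powr (b - 1) * s powr (k - 1)) * indicator {0<..} t * indicator {0<..} s"
  have "ennreal (Gamma b) * (\<integral>\<^sup>+s\<in>{0<..}. ennreal (base_profile c (- b) s * s powr (k - 1)) \<partial>lborel) =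
    (\<integral>\<^sup>+s. (\<integral>\<^sup>+t. ?h s t \<partial>lborel) \<partial>lborel)"
  proof (subst nn_integral_cmult[symmetric], goal_cases)
    case 2
    show ?case
    proof (rule nn_integral_cong)
      fix s :: real
      show "ennreal (Gamma b) * (ennreal (base_profile c (- b) s * s powr (k - 1)) * indicator {0<..} s) = (\<integral>\<^sup>+t. ?h s t \<partial>lborel)"
      proof (cases "s > 0")
        case True
        then have pos: "1 + c * s > 0" using c by (simp add: add_pos_pos)
        have "(\<integral>\<^sup>+t. ?h s t \<partial>lborel) = (\<integral>\<^sup>+t. ennreal (s powr (k - 1)) * (ennreal (exp (- ((1 + c * s) * t)) * t powr (b - 1)) * indicator {0<..} t) \<partial>lborel)"
          using True by (intro nn_integral_cong) (simp add: ennreal_mult'[symmetric] mult_ac split: split_indicator)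
        also have "\<dots> = ennreal (s powr (k - 1)) * (\<integral>\<^sup>+t\<in>{0<..}. ennreal (exp (- ((1 + c * s) * t)) * t powr (b - 1)) \<partial>lborel)"
          by (rule nn_integral_cmult) measurable
        also have "\<dots> = ennreal (s powr (k - 1)) * ennreal (Gamma b / (1 + c * s) powr b)"
          using b_pos pos by (simp add: nn_integral_Gamma_scaled)
        finally show ?thesis
          using True pos b_pos by (simp add: ennreal_mult'[symmetric] base_profile_def powr_minus_divide mult_ac)
      qed simp
    qed
  qed measurable
  also have "\<dots> = (\<integral>\<^sup>+t. (\<integral>\<^sup>+s. ?h s t \<partial>lborel) \<partial>lborel)"
    by (rule lborel_pair.Fubini') measurable
  also have "\<dots> = (\<integral>\<^sup>+t. ennreal (Gamma k * c powr (- k)) * (ennreal (exp (- (1 * t)) * t powr (b - k - 1)) * indicator {0<..} t) \<partial>lborel)"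
  proof (rule nn_integral_cong)
    fix t :: real
    show "(\<integral>\<^sup>+s. ?h s t \<partial>lborel) = ennreal (Gamma k * c powr (- k)) * (ennreal (exp (- (1 * t)) * t powr (b - k - 1)) * indicator {0<..} t)"
    proof (cases "t > 0")
      case True
      have "(\<integral>\<^sup>+s. ?h s t \<partial>lborel) = (\<integral>\<^sup>+s. ennreal (exp (- t) * t powr (b - 1)) * (ennreal (exp (- ((c * t) * s)) * s powr (k - 1)) * indicator {0<..} s) \<partial>lborel)"
        using True by (intro nn_integral_cong) (simp add: ennreal_mult'[symmetric] exp_add[symmetric] algebra_simps split: split_indicator)
      also have "\<dots> = ennreal (exp (- t) * t powr (b - 1)) * (\<integral>\<^sup>+s\<in>{0<..}. ennreal (exp (- ((c * t) * s)) * s powr (k - 1)) \<partial>lborel)"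
        by (rule nn_integral_cmult) measurable
      also have "\<dots> = ennreal (exp (- t) * t powr (b - 1)) * ennreal (Gamma k / (c * t) powr k)"
        using c True k by (simp add: nn_integral_Gamma_scaled)
      also have "\<dots> = ennreal (exp (- t) * t powr (b - 1) * (Gamma k / (c * t) powr k))"
        by (rule ennreal_mult'[symmetric]) simp
      also have "exp (- t) * t powr (b - 1) * (Gamma k / (c * t) powr k) = (Gamma k * c powr (- k)) * (exp (- (1 * t)) * t powr (b - k - 1))"
      proof -
        have "t powr (b - k - 1) = t powr (b - 1) * t powr (- k)" by (simp add: powr_add[symmetric] algebra_simps)
        then show ?thesis using c True by (simp add: powr_mult powr_minus_divide)
      qed
      finally show ?thesis using True k by (simp add: ennreal_mult')
    qed simp
  qed
  also have "\<dots> = ennreal (Gamma k * c powr (- k)) * (\<integral>\<^sup>+t\<in>{0<..}. ennreal (exp (- (1 * t)) * t powr (b - k - 1)) \<partial>lborel)"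
    by (rule nn_integral_cmult) measurable
  also have "\<dots> = ennreal (Gamma k * c powr (- k) * Gamma (b - k))"
    using nn_integral_Gamma_scaled[of "b - k" 1] b k by (simp add: ennreal_mult')
  finally have *: "ennreal (Gamma b) * (\<integral>\<^sup>+s\<in>{0<..}. ennreal (base_profile c (- b) s * s powr (k - 1)) \<partial>lborel) =
    ennreal (Gamma k * c powr (- k) * Gamma (b - k))" .
  have "(\<integral>\<^sup>+s\<in>{0<..}. ennreal (base_profile c (- b) s * s powr (k - 1)) \<partial>lborel) =
     (ennreal (1 / Gamma b) * ennreal (Gamma b)) * (\<integral>\<^sup>+s\<in>{0<..}. ennreal (base_profile c (- b) s * s powr (k - 1)) \<partial>lborel)"
    using Gamma_real_pos[OF b_pos] by (subst ennreal_mult'[symmetric]) auto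
  also have "\<dots> = ennreal (1 / Gamma b) * ennreal (Gamma k * c powr (- k) * Gamma (b - k))"
    by (simp only: mult.assoc *)
  also have "\<dots> = ennreal (1 / Gamma b * (Gamma k * c powr (- k) * Gamma (b - k)))"
    using Gamma_real_pos[OF b_pos] by (intro ennreal_mult'[symmetric]) simp
  also have "1 / Gamma b * (Gamma k * c powr (- k) * Gamma (b - k)) = Gamma k * (c powr (- k) * Gamma (b - k) / Gamma b)"
    by simp
  finally show ?thesis
    using b b_pos by (simp add: has_radial_moment_def Gamma_real_nonneg)
qed

text \<open>The radial profile of the density (\<open>j = 0\<close>), and what remains of it after division by the \<open>j\<close>-th power of
  the base. For \<open>p = 1\<close> the base is constantly \<open>1\<close> and all profiles agree.\<close>

definition profile :: "nat \<Rightarrow> real \<Rightarrow> nat \<Rightarrow> real \<Rightarrow> real"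
  where "profile n p j s =
    (if p = 1 then 1 / (2 * pi) powr (n / 2) * exp (- (s / 2))
     else gg_const n p * base_profile ((1 - p) / (2 * p - n * (1 - p))) (1 / (p - 1) - j) s)"

definition profile_moment :: "nat \<Rightarrow> real \<Rightarrow> nat \<Rightarrow> real \<Rightarrow> real"
  where "profile_moment n p j k =
    (let c = (1 - p) / (2 * p - n * (1 - p)) in
     if p = 1 then 1 / (2 * pi) powr (n / 2) * 2 powr k
     else if p < 1 then gg_const n p * (c powr (- k) * Gamma (1 / (1 - p) + j - k) / Gamma (1 / (1 - p) + j))
     else gg_const n p * ((- c) powr (- k) * Gamma (1 / (p - 1) - j + 1) / Gamma (1 / (p - 1) - j + 1 + k)))"

context
  fixes n :: nat and p :: real
  assumes n: "n > 0" and p: "real n / (real n + 2) < p" "p < 2"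
begin

lemma denom_pos: "2 * p - n * (1 - p) > 0" "2 * p + n * (p - 1) > 0" "p > 0"
proof -
  have "real n < p * (real n + 2)" using p by (simp add: pos_divide_less_eq)
  then show "2 * p - n * (1 - p) > 0" "2 * p + n * (p - 1) > 0" by (simp_all add: algebra_simps)
  show "p > 0" using p(1) by (rule le_less_trans[rotated]) simp
qed

lemma tail_exponent: "p < 1 \<Longrightarrow> 1 / (1 - p) - n / 2 > 0"
  using denom_pos(2) denom_pos(3) by (simp add: field_simps)

lemma tail_exponent_compact: "p > 1 \<Longrightarrow> 1 / (p - 1) > 1"
  using p by (simp add: field_simps)

lemma gg_const_pos: "p \<noteq> 1 \<Longrightarrow> gg_const n p > 0"
  using tail_exponent denom_pos
  by (auto simp: gg_const_def not_less_iff_gr_or_eq intro!: mult_pos_pos divide_pos_pos Gamma_real_pos add_pos_nonneg)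

lemma profile_nonneg: "profile n p j s \<ge> 0"
  using gg_const_pos by (simp add: profile_def base_profile_nonneg less_imp_le)

lemma borel_measurable_profile: "profile n p j \<in> borel_measurable borel"
  unfolding profile_def by measurable

text \<open>For \<open>p < 1\<close> the bound on \<open>k\<close> makes the integral converge at infinity; for \<open>p > 1\<close> convergence at the
  edge of the support requires \<open>1 / (p - 1) - j > -1\<close>, which for \<open>j = 2\<close> is the condition \<open>p < 2\<close>.\<close>

lemma profile_has_radial_moment:
  assumes j: "j \<le> 2" and k: "0 < k" "k \<le> n / 2 + j"
  shows "has_radial_moment (profile n p j) k (profile_moment n p j k)"
proof -
  consider "p = 1" | "p < 1" | "p > 1" by linarith
  then show ?thesis
  proof cases
    case 1
    have "has_radial_moment (\<lambda>s. 1 / (2 * pi) powr (n / 2) * exp (- (s / 2))) k (1 / (2 * pi) powr (n / 2) * 2 powr k)"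
      using k by (intro has_radial_moment_cmult has_radial_moment_exp) auto
    then show ?thesis using 1 by (simp add: profile_def[abs_def] profile_moment_def)
  next
    case 2
    let ?c = "(1 - p) / (2 * p - n * (1 - p))"
    have "?c > 0" using 2 denom_pos by simp
    moreover have "1 / (1 - p) + j > k" using tail_exponent[OF 2] k by linarith
    ultimately have "has_radial_moment (\<lambda>s. gg_const n p * base_profile ?c (- (1 / (1 - p) + j)) s) k
       (gg_const n p * (?c powr (- k) * Gamma (1 / (1 - p) + j - k) / Gamma (1 / (1 - p) + j)))"
      using k gg_const_pos 2 by (intro has_radial_moment_cmult has_radial_moment_base_profile_heavy) auto
    moreover have "- (1 / (1 - p) + j) = 1 / (p - 1) - j" using 2 by (simp add: field_simps)
    ultimately show ?thesis using 2 by (simp add: profile_def[abs_def] profile_moment_def)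
  next
    case 3
    let ?c = "(1 - p) / (2 * p - n * (1 - p))"
    have "?c < 0" using 3 denom_pos by (simp add: divide_neg_pos)
    moreover have "1 / (p - 1) - j > -1" using tail_exponent_compact[OF 3] j by linarith
    ultimately have "has_radial_moment (\<lambda>s. gg_const n p * base_profile ?c (1 / (p - 1) - j) s) k
       (gg_const n p * ((- ?c) powr (- k) * Gamma (1 / (p - 1) - j + 1) / Gamma (1 / (p - 1) - j + 1 + k)))"
      using k gg_const_pos 3 by (intro has_radial_moment_cmult has_radial_moment_base_profile_compact) auto
    then show ?thesis using 3 by (simp add: profile_def[abs_def] profile_moment_def Let_def)
  qed
qed

text \<open>The density has total mass one: the normalisation constant is the reciprocal of the radial integral.\<close>

lemma profile_moment_normalised: "profile_moment n p 0 (n / 2) * pi powr (n / 2) = 1"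
proof -
  consider "p = 1" | "p < 1" | "p > 1" by linarith
  then show ?thesis
  proof cases
    case 1
    then show ?thesis by (simp add: profile_moment_def powr_mult)
  next
    case 2
    define G1 G2 c where "G1 = Gamma (1 / (1 - p))" and "G2 = Gamma (1 / (1 - p) - n / 2)"
      and "c = (1 - p) / (2 * p - n * (1 - p))"
    have "G1 > 0" "G2 > 0"
      using tail_exponent 2 unfolding G1_def G2_def by (auto intro!: Gamma_real_pos)
    moreover have "c > 0" using 2 denom_pos by (simp add: c_def)
    moreover have "profile_moment n p 0 (n / 2) =
        c powr (n / 2) * (G1 / (pi powr (n / 2) * G2)) * (c powr (- (n / 2)) * G2 / G1)"
      using 2 by (simp add: profile_moment_def gg_const_def G1_def G2_def c_def)
    ultimately show ?thesis by (simp add: powr_minus)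
  next
    case 3
    have eq: "1 / (p - 1) + 1 = p / (p - 1)" using 3 by (simp add: field_simps)
    define G1 G2 c where "G1 = Gamma (p / (p - 1))" and "G2 = Gamma (p / (p - 1) + n / 2)"
      and "c = (p - 1) / (2 * p - n * (1 - p))"
    have "G1 > 0" "G2 > 0"
      using 3 unfolding G1_def G2_def by (auto intro!: Gamma_real_pos add_pos_nonneg)
    moreover have "c > 0" using 3 denom_pos by (simp add: c_def)
    moreover have "- ((1 - p) / (2 * p - n * (1 - p))) = c"
      by (simp add: c_def minus_divide_left)
    then have "profile_moment n p 0 (n / 2) =
        c powr (n / 2) * (G2 / (pi powr (n / 2) * G1)) * (c powr (- (n / 2)) * G1 / G2)"
      using 3 by (simp add: profile_moment_def gg_const_def G1_def G2_def eq Let_def flip: c_def)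
    ultimately show ?thesis by (simp add: powr_minus)
  qed
qed

text \<open>For \<open>p \<noteq> 1\<close> this is the functional equation of the Gamma function. Raising \<open>k\<close> and \<open>j\<close>
  together corresponds to an integration by parts, since the derivative of each profile is a multiple of the
  next one.\<close>

lemma profile_moment_step:
  assumes j: "j \<le> 1" and k: "0 < k" "k \<le> n / 2 + j"
  shows "profile_moment n p (Suc j) (k + 1) = profile_moment n p j k * (2 * p + n * (p - 1)) / (1 + j * (1 - p))"
proof -
  let ?q = "2 * p - n * (1 - p)"
  have q: "2 * p + n * (p - 1) = ?q" by (simp add: algebra_simps)
  have lower: "x powr (- 1 - k) = x powr (- k) / x" if "x > 0" for x :: real
  proof -
    have "- 1 - k = - k - 1" by simp
    then show ?thesis using that powr_diff[of x "- k" 1] by (simp only: powr_one less_imp_le)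
  qed
  consider "p = 1" | "p < 1" | "p > 1" by linarith
  then show ?thesis
  proof cases
    case 1
    then show ?thesis by (simp add: profile_moment_def powr_add)
  next
    case 2
    define b where "b = 1 / (1 - p) + j"
    have b: "b > 0" "b > k" using 2 tail_exponent[OF 2] k by (auto simp: b_def add_pos_nonneg)
    have G: "Gamma (b + 1) = b * Gamma b"
      using b by (intro Gamma_plus1) (auto elim!: nonpos_Ints_cases)
    have "profile_moment n p (Suc j) (k + 1) = gg_const n p * (((1 - p) / ?q) powr (- 1 - k) * Gamma (b - k) / Gamma (b + 1))"
      using 2 by (simp add: profile_moment_def b_def add_ac)
    also have "((1 - p) / ?q) powr (- 1 - k) = ((1 - p) / ?q) powr (- k) / ((1 - p) / ?q)"
      by (rule lower) (use 2 denom_pos in simp)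
    also have "gg_const n p * (((1 - p) / ?q) powr (- k) / ((1 - p) / ?q) * Gamma (b - k) / Gamma (b + 1)) =
       gg_const n p * (((1 - p) / ?q) powr (- k) * Gamma (b - k) / Gamma b) * (1 / (b * ((1 - p) / ?q)))"
      by (simp add: G mult_ac)
    also have "gg_const n p * (((1 - p) / ?q) powr (- k) * Gamma (b - k) / Gamma b) = profile_moment n p j k"
      using 2 by (simp add: profile_moment_def b_def)
    also have "b * ((1 - p) / ?q) = (1 + j * (1 - p)) / ?q"
    proof -
      have "b * (1 - p) = 1 + j * (1 - p)" using 2 by (simp add: b_def distrib_right)
      then show ?thesis by simp
    qed
    finally show ?thesis by (simp add: q)
  next
    case 3
    define a where "a = 1 / (p - 1) - j"
    have a: "a > 0" using tail_exponent_compact[OF 3] j by (simp add: a_def)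
    have G: "Gamma (a + 1) = a * Gamma a"
      using a by (intro Gamma_plus1) (auto elim!: nonpos_Ints_cases)
    have c: "- ((1 - p) / ?q) = (p - 1) / ?q" by (simp add: minus_divide_left)
    have "profile_moment n p (Suc j) (k + 1) = gg_const n p * (((p - 1) / ?q) powr (- 1 - k) * Gamma a / Gamma (a + 1 + k))"
      using 3 by (simp add: profile_moment_def a_def add_ac c Let_def)
    also have "((p - 1) / ?q) powr (- 1 - k) = ((p - 1) / ?q) powr (- k) / ((p - 1) / ?q)"
      by (rule lower) (use 3 denom_pos in simp)
    also have "gg_const n p * (((p - 1) / ?q) powr (- k) / ((p - 1) / ?q) * Gamma a / Gamma (a + 1 + k)) =
       gg_const n p * (((p - 1) / ?q) powr (- k) * Gamma (a + 1) / Gamma (a + 1 + k)) * (1 / (a * ((p - 1) / ?q)))"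
      using a by (simp add: G mult_ac)
    also have "gg_const n p * (((p - 1) / ?q) powr (- k) * Gamma (a + 1) / Gamma (a + 1 + k)) = profile_moment n p j k"
      using 3 by (simp add: profile_moment_def a_def c Let_def)
    also have "a * ((p - 1) / ?q) = (1 + j * (1 - p)) / ?q"
    proof -
      have "a * (p - 1) = 1 - j * (p - 1)" using 3 by (simp add: a_def left_diff_distrib)
      also have "\<dots> = 1 + j * (1 - p)" by (simp add: algebra_simps)
      finally show ?thesis by simp
    qed
    finally show ?thesis by (simp add: q)
  qed
qed

text \<open>For \<open>p \<noteq> 1\<close> again the functional equation of the Gamma function, applied once in the
  numerator and once in the denominator; for \<open>p = 1\<close> both sides agree because all profiles do.\<close>

lemma profile_moment_raise_exponent:
  "profile_moment n p 1 (n / 2) = profile_moment n p 0 (n / 2) * (2 + n * (p - 1)) / 2"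
proof -
  let ?q = "2 * p - n * (1 - p)"
  consider "p = 1" | "p < 1" | "p > 1" by linarith
  then show ?thesis
  proof cases
    case 1
    then show ?thesis by (simp add: profile_moment_def)
  next
    case 2
    define b where "b = 1 / (1 - p)"
    have b: "b > 0" "b - n / 2 > 0" using 2 tail_exponent[OF 2] by (auto simp: b_def)
    have G: "Gamma (b + 1) = b * Gamma b" "Gamma (b - n / 2 + 1) = (b - n / 2) * Gamma (b - n / 2)"
      using b by (intro Gamma_plus1; auto elim!: nonpos_Ints_cases)+
    have "profile_moment n p 1 (n / 2) = gg_const n p * (((1 - p) / ?q) powr (- (n / 2)) * Gamma (b - n / 2 + 1) / Gamma (b + 1))"
      using 2 by (simp add: profile_moment_def b_def algebra_simps)
    also have "\<dots> = gg_const n p * (((1 - p) / ?q) powr (- (n / 2)) * Gamma (b - n / 2) / Gamma b) * ((b - n / 2) / b)"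
      by (simp add: G mult_ac)
    also have "gg_const n p * (((1 - p) / ?q) powr (- (n / 2)) * Gamma (b - n / 2) / Gamma b) = profile_moment n p 0 (n / 2)"
      using 2 by (simp add: profile_moment_def b_def)
    also have "(b - n / 2) / b = (2 + n * (p - 1)) / 2"
      using 2 by (simp add: b_def field_simps)
    finally show ?thesis by simp
  next
    case 3
    define a where "a = 1 / (p - 1)"
    have a: "a > 0" using 3 by (simp add: a_def)
    have G: "Gamma (a + 1) = a * Gamma a" "Gamma (a + n / 2 + 1) = (a + n / 2) * Gamma (a + n / 2)"
      using a by (intro Gamma_plus1; auto elim!: nonpos_Ints_cases)+
    have "profile_moment n p 1 (n / 2) = gg_const n p * ((- ((1 - p) / ?q)) powr (- (n / 2)) * Gamma a / Gamma (a + n / 2))"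
      using 3 by (simp add: profile_moment_def a_def Let_def)
    also have "\<dots> = gg_const n p * ((- ((1 - p) / ?q)) powr (- (n / 2)) * Gamma (a + 1) / Gamma (a + n / 2 + 1)) * ((a + n / 2) / a)"
      using a by (simp add: G add_pos_nonneg)
    also have "gg_const n p * ((- ((1 - p) / ?q)) powr (- (n / 2)) * Gamma (a + 1) / Gamma (a + n / 2 + 1)) = profile_moment n p 0 (n / 2)"
      using 3 by (simp add: profile_moment_def a_def Let_def add_ac)
    also have "(a + n / 2) / a = (2 + n * (p - 1)) / 2"
      using 3 by (simp add: a_def field_simps)
    finally show ?thesis by simp
  qed
qed

end

section \<open>The score of the generalized Gaussian family\<close>

text \<open>The reciprocal of the base; multiplication by it passes from one profile to the next. It also is
  the weight that the score gives to the derivative of the quadratic form.\<close>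

definition damping :: "nat \<Rightarrow> real \<Rightarrow> real \<Rightarrow> real"
  where "damping n p s = 1 / (1 + (1 - p) / (2 * p - n * (1 - p)) * s)"

lemma profile_damping:
  fixes p :: real and n :: nat
  assumes "2 * p - n * (1 - p) > 0"
  shows "profile n p 0 s * damping n p s ^ j = profile n p j s"
proof (cases "p = 1")
  case True
  then show ?thesis by (simp add: profile_def damping_def)
next
  case False
  let ?b = "1 + (1 - p) / (2 * p - n * (1 - p)) * s"
  show ?thesis
  proof (cases "?b > 0")
    case True
    then have "?b powr (1 / (p - 1) - j) = ?b powr (1 / (p - 1)) / ?b ^ j"
      by (simp only: powr_diff powr_realpow)
    then show ?thesis using False True
      by (simp add: profile_def damping_def base_profile_def power_divide)
  qed (use False in \<open>simp add: profile_def base_profile_def\<close>)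
qed

lemma gen_gaussian_eq_profile:
  fixes p :: real and D :: "real^'n^'n"
  assumes D: "(D, u) \<in> param_space" and p: "2 * p - CARD('n) * (1 - p) > 0"
  shows "gen_gaussian p (D, u) z = sqrt (det D) * profile CARD('n) p 0 ((z - u) \<bullet> (D *v (z - u)))"
proof -
  let ?q = "(z - u) \<bullet> (D *v (z - u))"
  have q: "?q \<ge> 0"
    using D by (cases "z = u") (auto simp: param_space_def pos_def_matrices_def intro: less_imp_le)
  consider "p = 1" | "p < 1" | "p > 1" by linarith
  then show ?thesis
  proof cases
    case 1
    then show ?thesis by (simp add: gen_gaussian_def profile_def)
  next
    case 2
    have "(1 - p) / (2 * p - CARD('n) * (1 - p)) * ?q \<ge> 0"
      using 2 p q by simp
    then have "gg_base p D u z > 0"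
      unfolding gg_base_def by linarith
    then show ?thesis using 2
      by (simp add: gen_gaussian_def gg_dom_def profile_def base_profile_def gg_base_def)
  next
    case 3
    \<comment> \<open>On the boundary of the support the base is \<open>0\<close>, and so is its power.\<close>
    then show ?thesis
      by (cases "gg_base p D u z = 0") (auto simp: gen_gaussian_def gg_dom_def profile_def base_profile_def gg_base_def)
  qed
qed

text \<open>After whitening, the curve becomes \<open>det D\<close> times \<open>det (mat 1 + t *\<^sub>R X')\<close> with \<open>X' = transpose B ** X ** B\<close>.\<close>

lemma det_curve_has_derivative:
  fixes B D X :: "real^'n^'n"
  assumes B: "transpose B ** D ** B = mat 1"
  shows "((\<lambda>t. det (D + t *\<^sub>R X)) has_real_derivative det D * trace (matrix_inv D ** X)) (at 0)"
proof -
  note N = whitening_matrix_properties[OF B]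
  have "det (D + t *\<^sub>R X) = det D * det (mat 1 + t *\<^sub>R (transpose B ** X ** B))" for t
  proof -
    have "(D + t *\<^sub>R X) ** B = D ** B + t *\<^sub>R (X ** B)"
      by (simp add: matrix_matrix_mult_def vec_eq_iff algebra_simps sum.distrib sum_distrib_left)
    then have "transpose B ** (D + t *\<^sub>R X) ** B = transpose B ** D ** B + t *\<^sub>R (transpose B ** X ** B)"
      by (metis matrix_mul_assoc matrix_add_ldistrib matrix_scalar_ac scalar_matrix_assoc)
    then have "mat 1 + t *\<^sub>R (transpose B ** X ** B) = transpose B ** (D + t *\<^sub>R X) ** B"
      by (simp only: B)
    then have "det D * det (mat 1 + t *\<^sub>R (transpose B ** X ** B)) = (det B * det B * det D) * det (D + t *\<^sub>R X)"
      by (simp add: det_mul)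
    then show ?thesis by (simp add: N)
  qed
  moreover have "trace (transpose B ** X ** B) = trace (matrix_inv D ** X)"
    by (metis N(3) matrix_mul_assoc trace_mul_sym)
  ultimately show ?thesis
    using DERIV_cmult[OF det_one_plus_has_derivative_trace[of "transpose B ** X ** B"], of "det D"] by simp
qed

lemma quadratic_curve_has_derivative:
  fixes D X :: "real^'n^'n"
  assumes D: "transpose D = D"
  shows "((\<lambda>t. (w - t *\<^sub>R x) \<bullet> ((D + t *\<^sub>R X) *v (w - t *\<^sub>R x))) has_real_derivative
    w \<bullet> (X *v w) - 2 * (x \<bullet> (D *v w))) (at 0)"
proof -
  have sym: "w \<bullet> (D *v x) = x \<bullet> (D *v w)"
    by (metis D dot_lmul_matrix inner_commute transpose_matrix_vector)
  \<comment> \<open>The curve is a cubic polynomial in \<open>t\<close>, whose linear coefficient is the derivative.\<close>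
  have expand: "(w - t *\<^sub>R x) \<bullet> ((D + t *\<^sub>R X) *v (w - t *\<^sub>R x)) =
    w \<bullet> (D *v w) + t * (w \<bullet> (X *v w) - 2 * (x \<bullet> (D *v w)))
     + t^2 * (x \<bullet> (D *v x) - w \<bullet> (X *v x) - x \<bullet> (X *v w)) + t^3 * (x \<bullet> (X *v x))" for t
    by (simp add: matrix_vector_mult_add_rdistrib matrix_vector_mult_diff_distrib scaleR_matrix_vector_assoc[symmetric]
      matrix_vector_mult_scaleR inner_diff_left inner_diff_right inner_add_right sym power2_eq_square power3_eq_cube algebra_simps)
  show ?thesis
    unfolding expand by (auto intro!: derivative_eq_intros)
qed

text \<open>Near \<open>t = 0\<close> the determinant and the base stay positive, so the logarithm of the density splits into a
  constant, half the logarithm of the determinant, and a function of the quadratic form. For \<open>p \<noteq> 1\<close> the last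
  part is \<open>1 / (p - 1)\<close> times the logarithm of the base.\<close>

lemma score_has_derivative:
  fixes D X :: "real^'n^'n" and p :: real
  assumes D: "(D, u) \<in> param_space" and p: "2 * p - CARD('n) * (1 - p) > 0"
    and pos: "gen_gaussian p (D, u) z > 0"
  defines "w \<equiv> z - u"
  shows "((\<lambda>t. ln (gen_gaussian p ((D, u) + t *\<^sub>R (X, x)) z)) has_real_derivative
    trace (matrix_inv D ** X) / 2
     - (w \<bullet> (X *v w) - 2 * (x \<bullet> (D *v w))) * damping CARD('n) p (w \<bullet> (D *v w)) / (2 * p - CARD('n) * (1 - p))) (at 0)"
proof -
  let ?\<delta> = "\<lambda>t. det (D + t *\<^sub>R X)"
  let ?q = "\<lambda>t. (w - t *\<^sub>R x) \<bullet> ((D + t *\<^sub>R X) *v (w - t *\<^sub>R x))"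
  let ?r = "2 * p - CARD('n) * (1 - p)"
  let ?c = "(1 - p) / ?r"
  let ?q' = "w \<bullet> (X *v w) - 2 * (x \<bullet> (D *v w))"
  have Dpd: "D \<in> pos_def_matrices" using D by (simp add: param_space_def)
  then obtain B :: "real^'n^'n" where B: "transpose B ** D ** B = mat 1" using pos_def_whitening_matrix by blast
  have "det D > 0"
    using Dpd by (rule pos_def_det_pos)
  have \<delta>: "(?\<delta> has_real_derivative det D * trace (matrix_inv D ** X)) (at 0)"
    by (rule det_curve_has_derivative[OF B])
  have q: "(?q has_real_derivative ?q') (at 0)"
    using Dpd by (intro quadratic_curve_has_derivative) (simp add: pos_def_matrices_def sym_matrices_def)
  have curve: "gen_gaussian p ((D, u) + t *\<^sub>R (X, x)) z = gen_gaussian p (D + t *\<^sub>R X, u + t *\<^sub>R x) z" for t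
    by simp
  have shift: "z - (u + t *\<^sub>R x) = w - t *\<^sub>R x" for t by (simp add: w_def)
  have ln\<delta>: "((\<lambda>t. ln (?\<delta> t) / 2) has_real_derivative trace (matrix_inv D ** X) / 2) (at 0)"
    using \<open>det D > 0\<close> by (auto intro!: derivative_eq_intros \<delta>)
  have near: "\<forall>\<^sub>F t in nhds 0. h t > 0" if "(h has_real_derivative d) (at 0)" "h 0 > 0" for h d
    using DERIV_isCont[OF that(1)] that(2) order_tendstoD(1)[of h "h 0" "nhds 0" 0]
    by (simp add: isCont_def tendsto_at_iff_tendsto_nhds)
  have ev\<delta>: "\<forall>\<^sub>F t in nhds 0. ?\<delta> t > 0"
    using \<open>det D > 0\<close> by (intro near[OF \<delta>]) simp
  show ?thesis
  proof (cases "p = 1")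
    case True
    have "((\<lambda>t. - ln ((2 * pi) powr (CARD('n) / 2)) + ln (?\<delta> t) / 2 - ?q t / 2) has_real_derivative
        0 + trace (matrix_inv D ** X) / 2 - ?q' / 2) (at 0)"
      by (intro DERIV_add DERIV_diff DERIV_const DERIV_cdivide ln\<delta> q)
    moreover have "\<forall>\<^sub>F t in nhds 0. ln (gen_gaussian p ((D, u) + t *\<^sub>R (X, x)) z) =
        - ln ((2 * pi) powr (CARD('n) / 2)) + ln (?\<delta> t) / 2 - ?q t / 2"
      using ev\<delta>
    proof eventually_elim
      case (elim t)
      then show ?case
        using True by (simp only: curve) (simp add: gen_gaussian_def shift ln_mult ln_div ln_sqrt)
    qed
    ultimately show ?thesis
      using True by (subst DERIV_cong_ev[OF refl _ refl]) (auto simp: damping_def)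
  next
    case False
    have "profile CARD('n) p 0 (w \<bullet> (D *v w)) > 0"
      using pos \<open>det D > 0\<close> unfolding gen_gaussian_eq_profile[OF D p] by (simp add: w_def zero_less_mult_iff)
    then have b': "1 + ?c * (w \<bullet> (D *v w)) > 0" and A: "gg_const CARD('n) p > 0"
      using False by (auto simp: profile_def base_profile_def zero_less_mult_iff split: if_splits)
    then have b: "1 + ?c * ?q 0 > 0" by simp
    have deriv_b: "((\<lambda>t. 1 + ?c * ?q t) has_real_derivative ?c * ?q') (at 0)"
      using DERIV_add[OF DERIV_const[of 1] DERIV_cmult[OF q, of ?c]] by simp
    have evb: "\<forall>\<^sub>F t in nhds 0. 1 + ?c * ?q t > 0"
      by (rule near[OF deriv_b b])
    have "((\<lambda>t. ln (gg_const CARD('n) p) + ln (?\<delta> t) / 2 + 1 / (p - 1) * ln (1 + ?c * ?q t)) has_real_derivative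
        0 + trace (matrix_inv D ** X) / 2 + 1 / (p - 1) * (1 / (1 + ?c * ?q 0) * (?c * ?q'))) (at 0)"
      by (intro DERIV_add DERIV_const DERIV_cmult ln\<delta> DERIV_chain2[OF DERIV_ln_divide[OF b] deriv_b])
    \<comment> \<open>The exponent cancels the factor \<open>1 - p\<close> of the base, leaving \<open>- 1 / ?r\<close>.\<close>
    moreover have "1 / (p - 1) * (1 / (1 + ?c * ?q 0) * (?c * ?q')) = - (?q' * damping CARD('n) p (w \<bullet> (D *v w)) / ?r)"
    proof -
      have "1 / (p - 1) * ?c = - 1 / ?r"
        using False by (simp add: divide_simps)
      then have "(1 / (p - 1) * ?c) * (?q' / (1 + ?c * ?q 0)) = - 1 / ?r * (?q' / (1 + ?c * ?q 0))"
        by (simp only:)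
      also have "(1 / (p - 1) * ?c) * (?q' / (1 + ?c * ?q 0)) = 1 / (p - 1) * (1 / (1 + ?c * ?q 0) * (?c * ?q'))"
        by (simp add: mult_ac)
      finally have "1 / (p - 1) * (1 / (1 + ?c * ?q 0) * (?c * ?q')) = - 1 / ?r * (?q' / (1 + ?c * ?q 0))" .
      then show ?thesis by (simp add: damping_def mult_ac)
    qed
    moreover have "\<forall>\<^sub>F t in nhds 0. ln (gen_gaussian p ((D, u) + t *\<^sub>R (X, x)) z) =
        ln (gg_const CARD('n) p) + ln (?\<delta> t) / 2 + 1 / (p - 1) * ln (1 + ?c * ?q t)"
      using ev\<delta> evb
    proof eventually_elim
      case (elim t)
      then have "gen_gaussian p ((D, u) + t *\<^sub>R (X, x)) z = gg_const CARD('n) p * sqrt (?\<delta> t) * (1 + ?c * ?q t) powr (1 / (p - 1))"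
        using False by (simp only: curve) (simp add: gen_gaussian_def gg_dom_def gg_base_def shift)
      then show ?case
        using elim A by (simp add: ln_mult ln_powr ln_sqrt)
    qed
    ultimately show ?thesis
      by (subst DERIV_cong_ev[OF refl _ refl]) auto
  qed
qed

section \<open>The Fisher information\<close>

text \<open>The theorem for \<open>D = mat 1\<close> and \<open>u = 0\<close>. The product of the two scores involves the profiles
  \<open>j = 0, 1, 2\<close>, multiplied by forms of degree at most \<open>4\<close>; the terms of odd degree integrate to zero.\<close>

lemma whitened_score_covariance:
  fixes X Y :: "real^'n^'n" and x y :: "real^'n" and p :: real
  assumes p: "real CARD('n) / (real CARD('n) + 2) < p" "p < 2" and Y: "transpose Y = Y"
  defines "r \<equiv> 2 * p + CARD('n) * (p - 1)"
  shows "has_bochner_integral lborel (\<lambda>v::real^'n. profile CARD('n) p 0 ((norm v)\<^sup>2) *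
      (trace X / 2 - (v \<bullet> (X *v v) - 2 * (x \<bullet> v)) * damping CARD('n) p ((norm v)\<^sup>2) / r) *
      (trace Y / 2 - (v \<bullet> (Y *v v) - 2 * (y \<bullet> v)) * damping CARD('n) p ((norm v)\<^sup>2) / r))
    (1 / (2 * (2 - p)) * trace (X ** Y) + (p - 1) / (4 * (2 - p)) * (trace X * trace Y) +
      (2 + CARD('n) * (p - 1)) / (r * (2 - p)) * (x \<bullet> y))"
proof -
  define n where "n = CARD('n)"
  have n: "n > 0" by (simp add: n_def)
  note np = n p[folded n_def]
  define C where "C = pi powr (n / 2)"
  let ?g = "\<lambda>j. profile n p j" and ?L = "profile_moment n p"
  have q: "2 * p - n * (1 - p) = r" by (simp add: r_def n_def algebra_simps)
  have r: "r > 0" using denom_pos(1)[OF np] q by simp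
  have g: "?g j \<in> borel_measurable borel" "?g j s \<ge> 0" for j s
    using borel_measurable_profile[OF np] profile_nonneg[OF np] by auto
  note moment = profile_has_radial_moment[OF np]
  have sq: "?g 0 s * damping n p s = ?g 1 s" "?g 0 s * (damping n p s * damping n p s) = ?g 2 s" for s
    using profile_damping[of p n s 1] profile_damping[of p n s 2] r q by (simp_all add: power2_eq_square)
  have half: "real n / 2 > 0" using n by simp
  \<comment> \<open>The normalisation determines all moments that occur.\<close>
  have L0: "?L 0 (n / 2) * C = 1" using profile_moment_normalised[OF np] by (simp add: C_def)
  have L1: "?L 1 (n / 2 + 1) * C = r"
    using profile_moment_step[OF np, of 0 "n / 2"] half L0 q by (simp add: r_def n_def)
  have step: "?L 2 (k + 1) = ?L 1 k * r / (2 - p)" if "0 < k" "k \<le> n / 2 + 1" for k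
    using profile_moment_step[OF np, of 1 k] that by (simp add: r_def n_def numeral_2_eq_2)
  have L2: "?L 2 (n / 2 + 1) * C = (2 + n * (p - 1)) / 2 * r / (2 - p)"
  proof -
    have "?L 2 (n / 2 + 1) * C = (?L 0 (n / 2) * C) * ((2 + n * (p - 1)) / 2 * r / (2 - p))"
      unfolding step[OF half, simplified] profile_moment_raise_exponent[OF np, unfolded One_nat_def] by simp
    then show ?thesis by (simp only: L0 mult_1)
  qed
  have L4: "?L 2 (n / 2 + 2) * C = r * r / (2 - p)"
  proof -
    have "?L 2 (n / 2 + 2) * C = (?L 1 (n / 2 + 1) * C) * (r / (2 - p))"
      using step[of "n / 2 + 1"] half by (simp add: add.assoc)
    then show ?thesis unfolding L1 by simp
  qed
  have m: "has_radial_moment (?g j) (CARD('n) / 2 + k) (?L j (n / 2 + k))" if "j \<le> 2" "k \<ge> 0" "k \<le> j" for j k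
    using moment[of j "n / 2 + k"] half that unfolding n_def[symmetric] by simp
  have "has_radial_moment (?g 0) ((CARD('n) + real (length ([] :: 'n list))) / 2) (?L 0 (n / 2))"
    using m[of 0 0] by simp
  from has_bochner_integral_word_radial[OF g this]
  have I0: "has_bochner_integral lborel (\<lambda>v::real^'n. ?g 0 ((norm v)\<^sup>2)) 1"
    unfolding prod_gaussian_moment_count n_def[symmetric] C_def[symmetric] using L0 by simp
  have I1: "has_bochner_integral lborel (\<lambda>v::real^'n. ?g 1 ((norm v)\<^sup>2) * (z \<bullet> v)) 0" for z
    by (rule radial_linear_moment[OF g m]) auto
  have I2: "has_bochner_integral lborel (\<lambda>v::real^'n. ?g 1 ((norm v)\<^sup>2) * (v \<bullet> (Z *v v))) (r / 2 * trace Z)" for Z :: "real^'n^'n"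
    using radial_quadratic_moment[OF g m[of 1 1], of Z] unfolding n_def[symmetric] C_def[symmetric] L1 by simp
  have I3: "has_bochner_integral lborel (\<lambda>v::real^'n. ?g 2 ((norm v)\<^sup>2) * ((v \<bullet> (Z *v v)) * (z \<bullet> v))) 0" for Z :: "real^'n^'n" and z
    by (rule radial_cubic_moment[OF g m]) auto
  have I2': "has_bochner_integral lborel (\<lambda>v::real^'n. ?g 2 ((norm v)\<^sup>2) * ((x \<bullet> v) * (y \<bullet> v)))
      ((2 + n * (p - 1)) / 2 * r / (2 - p) / 2 * (x \<bullet> y))"
    using radial_bilinear_moment[OF g m[of 2 1], of x y] unfolding n_def[symmetric] C_def[symmetric] L2 by simp
  have I4: "has_bochner_integral lborel (\<lambda>v::real^'n. ?g 2 ((norm v)\<^sup>2) * ((v \<bullet> (X *v v)) * (v \<bullet> (Y *v v))))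
      (r * r / (2 - p) / 4 * (trace X * trace Y + 2 * trace (X ** Y)))"
    using radial_quartic_moment[OF g m[of 2 2] Y, of X] unfolding n_def[symmetric] C_def[symmetric] L4 by simp
  \<comment> \<open>Multiplying out the two scores; each power of the damping factor moves on to the next profile.\<close>
  let ?tX = "trace X" and ?tY = "trace Y"
  let ?J = "\<lambda>v. (?tX * ?tY / 4) * ?g 0 ((norm v)\<^sup>2)
     - (?tX / (2 * r)) * (?g 1 ((norm v)\<^sup>2) * (v \<bullet> (Y *v v))) + (?tX / r) * (?g 1 ((norm v)\<^sup>2) * (y \<bullet> v))
     - (?tY / (2 * r)) * (?g 1 ((norm v)\<^sup>2) * (v \<bullet> (X *v v))) + (?tY / r) * (?g 1 ((norm v)\<^sup>2) * (x \<bullet> v))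
     + (1 / (r * r)) * (?g 2 ((norm v)\<^sup>2) * ((v \<bullet> (X *v v)) * (v \<bullet> (Y *v v))))
     - (2 / (r * r)) * (?g 2 ((norm v)\<^sup>2) * ((v \<bullet> (X *v v)) * (y \<bullet> v)))
     - (2 / (r * r)) * (?g 2 ((norm v)\<^sup>2) * ((v \<bullet> (Y *v v)) * (x \<bullet> v)))
     + (4 / (r * r)) * (?g 2 ((norm v)\<^sup>2) * ((x \<bullet> v) * (y \<bullet> v)))"
  have "has_bochner_integral lborel ?J ((?tX * ?tY / 4) * 1
     - (?tX / (2 * r)) * (r / 2 * ?tY) + (?tX / r) * 0 - (?tY / (2 * r)) * (r / 2 * ?tX) + (?tY / r) * 0
     + (1 / (r * r)) * (r * r / (2 - p) / 4 * (?tX * ?tY + 2 * trace (X ** Y)))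
     - (2 / (r * r)) * 0 - (2 / (r * r)) * 0
     + (4 / (r * r)) * ((2 + n * (p - 1)) / 2 * r / (2 - p) / 2 * (x \<bullet> y)))" (is "has_bochner_integral _ _ ?V")
    by (intro has_bochner_integral_add has_bochner_integral_diff has_bochner_integral_mult_right I0 I1 I2 I3 I2' I4)
  moreover have "?J v = profile n p 0 ((norm v)\<^sup>2) *
      (?tX / 2 - (v \<bullet> (X *v v) - 2 * (x \<bullet> v)) * damping n p ((norm v)\<^sup>2) / r) *
      (?tY / 2 - (v \<bullet> (Y *v v) - 2 * (y \<bullet> v)) * damping n p ((norm v)\<^sup>2) / r)" for v
  proof -
    have alg: "(a * b / 4) * g0 - (a / (2 * r)) * (g0 * m * B) + (a / r) * (g0 * m * yv)
     - (b / (2 * r)) * (g0 * m * A) + (b / r) * (g0 * m * xv)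
     + (1 / (r * r)) * (g0 * (m * m) * (A * B)) - (2 / (r * r)) * (g0 * (m * m) * (A * yv))
     - (2 / (r * r)) * (g0 * (m * m) * (B * xv)) + (4 / (r * r)) * (g0 * (m * m) * (xv * yv))
     = g0 * (a / 2 - (A - 2 * xv) * m / r) * (b / 2 - (B - 2 * yv) * m / r)" for a b A B g0 m xv yv
      using r by (simp add: divide_simps) (simp add: algebra_simps)
    show ?thesis unfolding sq[symmetric] by (rule alg)
  qed
  moreover have "?V = 1 / (2 * (2 - p)) * trace (X ** Y) + (p - 1) / (4 * (2 - p)) * (trace X * trace Y) +
      (2 + n * (p - 1)) / (r * (2 - p)) * (x \<bullet> y)"
  proof -
    have alg: "a * b / 4 * 1 - a / (2 * r) * (r / 2 * b) + (a / r) * 0 - b / (2 * r) * (r / 2 * a) + (b / r) * 0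
      + (1 / (r * r)) * (r * r / (2 - p) / 4 * (a * b + 2 * tr)) - (2 / (r * r)) * 0 - (2 / (r * r)) * 0
      + (4 / (r * r)) * (e / 2 * r / (2 - p) / 2 * xy)
      = 1 / (2 * (2 - p)) * tr + (p - 1) / (4 * (2 - p)) * (a * b) + e / (r * (2 - p)) * xy" for a b tr e xy
    proof -
      have "2 - p \<noteq> 0" "r \<noteq> 0" using p r by auto
      then show ?thesis by (simp add: divide_simps) (simp add: algebra_simps)
    qed
    show ?thesis by (rule alg)
  qed
  ultimately show ?thesis unfolding n_def[symmetric] by (simp only:)
qed

theorem theorem3p4:
  fixes p :: real and D X Y :: "real^'n^'n" and u x y :: "real^'n"
  assumes "real CARD('n) / (real CARD('n) + 2) < p" and "p < 2"
    and "(D, u) \<in> param_space"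
    and "(X, x) \<in> tangent_space" and "(Y, y) \<in> tangent_space"
  shows "(\<forall>z. gen_gaussian p (D, u) z > 0 \<longrightarrow>
            tangent_differentiable (\<lambda>\<eta>. ln (gen_gaussian p \<eta> z)) (D, u) (X, x) \<and>
            tangent_differentiable (\<lambda>\<eta>. ln (gen_gaussian p \<eta> z)) (D, u) (Y, y)) \<and>
         set_integrable lborel {z. gen_gaussian p (D, u) z > 0}
            (fisher_integrand (gen_gaussian p) (D, u) (X, x) (Y, y)) \<and>
         fisher_form (gen_gaussian p) (D, u) (X, x) (Y, y) =
            1 / (2 * (2 - p)) * trace (matrix_inv D ** X ** matrix_inv D ** Y)
          + (p - 1) / (4 * (2 - p)) * trace (matrix_inv D ** X) * trace (matrix_inv D ** Y)
          + (2 + real CARD('n) * (p - 1)) / ((2 * p + real CARD('n) * (p - 1)) * (2 - p))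
              * (x \<bullet> (D *v y))"
proof -
  define n where "n = CARD('n)"
  have np: "n > 0" "real n / (real n + 2) < p" "p < 2" using assms by (simp_all add: n_def)
  let ?f = "gen_gaussian p"
  let ?r = "2 * p + n * (p - 1)"
  let ?q = "\<lambda>w. w \<bullet> (D *v w)"
  define S where "S = (\<lambda>(X::real^'n^'n) (x::real^'n) w. trace (matrix_inv D ** X) / 2
    - (w \<bullet> (X *v w) - 2 * (x \<bullet> (D *v w))) * damping n p (?q w) / ?r)"
  have r: "2 * p - n * (1 - p) = ?r" by (simp add: algebra_simps)
  have r_pos: "2 * p - CARD('n) * (1 - p) > 0" using denom_pos(1)[OF np] by (simp add: n_def)
  have Dpd: "D \<in> pos_def_matrices" using assms(3) by (simp add: param_space_def)
  then obtain B :: "real^'n^'n" where B: "transpose B ** D ** B = mat 1" using pos_def_whitening_matrix by blast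
  note N = whitening_matrix_properties[OF B]
  have detB: "det B \<noteq> 0" using N(4) by auto
  have detD: "det D > 0" using Dpd by (rule pos_def_det_pos)
  have score: "((\<lambda>t. ln (?f ((D, u) + t *\<^sub>R (Z, \<zeta>)) z)) has_real_derivative S Z \<zeta> (z - u)) (at 0)"
    if "?f (D, u) z > 0" for Z \<zeta> z
    using score_has_derivative[OF assms(3) r_pos that, of Z \<zeta>] by (simp add: S_def n_def r[unfolded n_def])
  have f: "?f (D, u) z = sqrt (det D) * profile n p 0 (?q (z - u))" for z
    using gen_gaussian_eq_profile[OF assms(3) r_pos] by (simp add: n_def)
  have f_nonneg: "?f (D, u) z \<ge> 0" for z
    unfolding f using profile_nonneg[OF np] detD by simp
  \<comment> \<open>Outside its support the density vanishes, so the restricted integrand extends to all of space.\<close>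
  define h where "h = (\<lambda>z. sqrt (det D) * (profile n p 0 (?q (z - u)) * S X x (z - u) * S Y y (z - u)))"
  have h: "indicator {z. ?f (D, u) z > 0} z *\<^sub>R fisher_integrand ?f (D, u) (X, x) (Y, y) z = h z" for z
  proof (cases "?f (D, u) z > 0")
    case True
    then show ?thesis
      using score[OF True, THEN DERIV_imp_deriv] by (simp add: fisher_integrand_def tangent_deriv_def h_def f)
  next
    case False
    then have "?f (D, u) z = 0" using f_nonneg[of z] by simp
    then show ?thesis using False by (auto simp: h_def f)
  qed
  let ?tr = "\<lambda>Z. transpose B ** Z ** B"
  let ?V = "1 / (2 * (2 - p)) * trace (?tr X ** ?tr Y) + (p - 1) / (4 * (2 - p)) * (trace (?tr X) * trace (?tr Y)) +
      (2 + n * (p - 1)) / (?r * (2 - p)) * ((transpose B *v (D *v x)) \<bullet> (transpose B *v (D *v y)))"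
  have adj: "(transpose B *v a) \<bullet> b = a \<bullet> (B *v b)" for a b
    by (simp add: dot_lmul_matrix)
  have conj: "(B *v v) \<bullet> (Z *v (B *v v)) = v \<bullet> (?tr Z *v v)" for Z v
    by (simp only: inner_commute[of "B *v v"] adj[symmetric] matrix_vector_mul_assoc[symmetric]) (rule inner_commute)
  have q: "?q (B *v v) = (norm v)\<^sup>2" for v
    unfolding conj B by (simp add: power2_norm_eq_inner)
  have trace_tr: "trace (?tr Z) = trace (matrix_inv D ** Z)" for Z
    by (metis N(3) matrix_mul_assoc trace_mul_sym)
  have D_sym: "transpose D = D" using Dpd by (simp add: pos_def_matrices_def sym_matrices_def)
  \<comment> \<open>The Jacobian of the whitening map cancels the factor \<open>sqrt (det D)\<close> of the density.\<close>
  have vol: "\<bar>det B\<bar> * sqrt (det D) = 1"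
  proof -
    have "sqrt (det B * det B * det D) = 1" by (simp add: N)
    then show ?thesis by (simp add: real_sqrt_mult)
  qed
  have int: "has_bochner_integral lborel h ?V"
  proof (rule has_bochner_integral_lborel_translate[where u = u])
    define H where "H = (\<lambda>w. sqrt (det D) * (profile n p 0 (?q w) * S X x w * S Y y w))"
    have [measurable]: "(*v) A \<in> borel_measurable borel" for A :: "real^'n^'n"
      by (intro borel_measurable_continuous_onI continuous_intros)
    have [measurable]: "profile n p 0 \<in> borel_measurable borel" "damping n p \<in> borel_measurable borel"
      using borel_measurable_profile[OF np] by (auto simp: damping_def[abs_def])
    show "h \<in> borel_measurable borel"
      unfolding h_def S_def by measurable
    have H: "H \<in> borel_measurable borel"
      unfolding H_def S_def by measurable
    have S: "S Z \<zeta> (B *v v) = trace (?tr Z) / 2 -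
       (v \<bullet> (?tr Z *v v) - 2 * ((transpose B *v (D *v \<zeta>)) \<bullet> v)) * damping n p ((norm v)\<^sup>2) / ?r" for Z \<zeta> v
    proof -
      have "\<zeta> \<bullet> (D *v (B *v v)) = (transpose B *v (D *v \<zeta>)) \<bullet> v"
        unfolding adj by (metis D_sym dot_lmul_matrix transpose_matrix_vector)
      then show ?thesis unfolding S_def unfolding q by (simp only: conj trace_tr)
    qed
    have sym: "transpose (?tr Y) = ?tr Y"
      using assms(5) by (simp add: tangent_space_def sym_matrices_def matrix_transpose_mul transpose_transpose matrix_mul_assoc)
    have "has_bochner_integral lborel (\<lambda>v. \<bar>det B\<bar> * H (B *v v)) ?V"
    proof -
      have "\<bar>det B\<bar> * H (B *v v) = profile n p 0 ((norm v)\<^sup>2) * S X x (B *v v) * S Y y (B *v v)" for v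
        unfolding H_def q mult.assoc[symmetric] vol by simp
      then show ?thesis
        unfolding S using whitened_score_covariance[OF assms(1,2) sym, of "?tr X" "transpose B *v (D *v x)" "transpose B *v (D *v y)"]
        by (simp only: n_def)
    qed
    then have "has_bochner_integral lborel H ?V"
      by (rule has_bochner_integral_lborel_linear[OF H detB])
    then show "has_bochner_integral lborel (\<lambda>w. h (u + w)) ?V"
      by (simp add: H_def h_def)
  qed
  have V: "?V = 1 / (2 * (2 - p)) * trace (matrix_inv D ** X ** matrix_inv D ** Y)
          + (p - 1) / (4 * (2 - p)) * trace (matrix_inv D ** X) * trace (matrix_inv D ** Y)
          + (2 + real n * (p - 1)) / (?r * (2 - p)) * (x \<bullet> (D *v y))"
  proof -
    have "trace (?tr X ** ?tr Y) = trace (transpose B ** (X ** B ** transpose B ** Y ** B))"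
      by (simp only: matrix_mul_assoc)
    also have "\<dots> = trace ((X ** B ** transpose B ** Y ** B) ** transpose B)"
      by (rule trace_mul_sym)
    also have "\<dots> = trace ((X ** matrix_inv D ** Y) ** matrix_inv D)"
      by (simp only: N(3) matrix_mul_assoc)
    also have "\<dots> = trace (matrix_inv D ** (X ** matrix_inv D ** Y))"
      by (rule trace_mul_sym)
    finally have 1: "trace (?tr X ** ?tr Y) = trace (matrix_inv D ** X ** matrix_inv D ** Y)"
      by (simp only: matrix_mul_assoc)
    have "(transpose B *v (D *v x)) \<bullet> (transpose B *v (D *v y)) = (D *v x) \<bullet> ((B ** transpose B ** D) *v y)"
      by (simp only: adj matrix_vector_mul_assoc[symmetric])
    also have "\<dots> = x \<bullet> (D *v y)"
      unfolding N(1) by (metis D_sym dot_lmul_matrix matrix_vector_mul_lid transpose_matrix_vector)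
    finally show ?thesis by (simp only: 1 trace_tr mult.assoc)
  qed
  have "tangent_differentiable (\<lambda>\<eta>. ln (?f \<eta> z)) (D, u) (Z, \<zeta>)" if "?f (D, u) z > 0" for z Z \<zeta>
    using score[OF that] unfolding tangent_differentiable_def field_differentiable_def by blast
  moreover have "set_integrable lborel {z. ?f (D, u) z > 0} (fisher_integrand ?f (D, u) (X, x) (Y, y))"
    unfolding set_integrable_def h using int by (rule integrable.intros)
  moreover have "fisher_form ?f (D, u) (X, x) (Y, y) = ?V"
    unfolding fisher_form_def set_lebesgue_integral_def h using int by (rule has_bochner_integral_integral_eq)
  ultimately show ?thesis unfolding V by (simp add: n_def)
qed

end
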